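(* Let $\alpha,\beta>-1$. For each $n$ let $\ell_1^{(n)},\dots,\ell_n^{(n)}$ be the Lagrange basis polynomials for the $n$ Jacobi-Gauss-Radau points that are the roots of $(1+x)P_{n-1}^{(\alpha,\beta)}(x)$. Then $$\max_{1\le j\le n}\|\ell_j^{(n)}\|_\infty=\begin{cases} O\left(n^{-\min\{0,\beta+\frac12,\beta-\alpha\}}\right),&-1<\beta\le\frac12,\\ O\left(n^{-\min\{0,\frac12-\alpha,\frac52-\beta,\beta-\alpha\}}\right),&\beta>\frac12. \end{cases}$$
   Context: $P_m^{(\alpha,\beta)}$ is the Jacobi polynomial of degree $m$ (orthogonal on $[-1,1]$ with respect to the weight $(1-t)^\alpha(1+t)^\beta$, normalized by $P_m^{(\alpha,\beta)}(1)=\binom{m+\alpha}{m}$); its $m$ roots are simple and lie in $(-1,1)$. For distinct nodes $x_1,\dots,x_n$ with $\omega_n(x)=\prod_i(x-x_i)$, the Lagrange basis polynomials are $\ell_k^{(n)}(x)=\frac{\omega_n(x)}{\omega_n'(x_k)(x-x_k)}$. $\|\cdot\|_\infty$ is the supremum norm on $[-1,1]$. The $O$-constants depend only on $\alpha,\beta$, and the asymptotics are as $n\to\infty$. *)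

theory Defs
  imports
    "HOL-Analysis.Analysis"
    "HOL-Computational_Algebra.Polynomial"
    "HOL-Library.Landau_Symbols"
begin

text \<open>For \<open>\<alpha>, \<beta> > -1\<close> the weight is Lebesgue integrable on \<open>[-1, 1]\<close>; the values of
  \<open>powr\<close> at the end points do not matter.\<close>

definition jacobi_weight :: "real \<Rightarrow> real \<Rightarrow> real \<Rightarrow> real" where
  "jacobi_weight \<alpha> \<beta> t = (1 - t) powr \<alpha> * (1 + t) powr \<beta>"

definition is_jacobi_family :: "real \<Rightarrow> real \<Rightarrow> (nat \<Rightarrow> real poly) \<Rightarrow> bool" where
  "is_jacobi_family \<alpha> \<beta> P \<longleftrightarrow>
     (\<forall>m. degree (P m) = m) \<and>
     (\<forall>m k. m \<noteq> k \<longrightarrow>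
        (LINT t:{-1..1}|lborel. poly (P m) t * poly (P k) t * jacobi_weight \<alpha> \<beta> t) = 0) \<and>
     (\<forall>m. poly (P m) 1 = (real m + \<alpha>) gchoose m)"

text \<open>Only meaningful for \<open>\<alpha>, \<beta> > -1\<close>, where such a family exists and is unique.\<close>

definition jacobi :: "real \<Rightarrow> real \<Rightarrow> nat \<Rightarrow> real poly" where
  "jacobi \<alpha> \<beta> = (THE P. is_jacobi_family \<alpha> \<beta> P)"

text \<open>The nodes are numbered from \<open>1\<close> to \<open>n\<close> in increasing order, for \<open>n \<ge> 1\<close>.\<close>

definition radau_node :: "real \<Rightarrow> real \<Rightarrow> nat \<Rightarrow> nat \<Rightarrow> real" where
  "radau_node \<alpha> \<beta> n k =
     sorted_list_of_set {x. poly ([:1, 1:] * jacobi \<alpha> \<beta> (n - 1)) x = 0} ! (k - 1)"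

definition node_poly :: "nat \<Rightarrow> (nat \<Rightarrow> real) \<Rightarrow> real poly" where
  "node_poly n x = (\<Prod>i=1..n. [:- x i, 1:])"

text \<open>The quotient is taken in the polynomial ring (it is exact when \<open>1 \<le> k \<le> n\<close>), so that
  evaluation at the node \<open>x k\<close> itself is not affected by division by zero.\<close>

definition lagrange_basis :: "nat \<Rightarrow> (nat \<Rightarrow> real) \<Rightarrow> nat \<Rightarrow> real poly" where
  "lagrange_basis n x k =
     smult (1 / poly (pderiv (node_poly n x)) (x k)) (node_poly n x div [:- x k, 1:])"

definition sup_norm :: "(real \<Rightarrow> real) \<Rightarrow> real" where
  "sup_norm f = (SUP t\<in>{-1..1}. \<bar>f t\<bar>)"

end

(* The Jacobi polynomial y of degree m solves the Jacobi equation with eigenvalue lam of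
   order m^2.  Let E be the energy of its Liouville normal form.  Then
   |E'| <= K / sqrt lam * (1 - x^2)^(-3/2) * E, and (1 - x^2)^(-3/2) is the derivative of
   x / sqrt (1 - x^2); so all values of E at points at distance >= eps / lam from 1 and -1 are
   comparable.  Within that distance of an end point, y is within a third of its value there.
   This bounds |y| and |y'| from above on [-1, 1], and |y'| from below at the roots, in terms of
   E(0) alone, which cancels in the Lagrange polynomials
   (1 + t) y(t) / ((1 + x) y'(x) (t - x)) and y(t) / y(-1).  What remains is a comparison of
   powers of the distances of t and x to 1 and -1; if t is close to x, the mean value theorem
   replaces it. *)

theory Submission
  imports Defs
begin

section \<open>The Jacobi equation and its energy\<close>

text \<open>Energy control cannot reach the end points: \<open>x / sqrt (1 - x^2)\<close> is
  unbounded there, and it stays below a multiple of \<open>sqrt lam\<close> only down to distances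
  of order \<open>1 / lam\<close>. That is the scale on which the singular end point takes over, so
  the two methods meet at one point, and adding \<open>1 / lam\<close> to each distance yields power
  laws valid on all of [-1, 1]. Only squares are estimated, because the energy is quadratic; as lam
  is of order n^2, a bound lam^e for squares means n^e for the polynomials. The exponents stem from
  points at distance about 1/lam from an end: t near 1 with x in the middle costs \<alpha> - 1/2, t
  near -1 with x in the middle \<beta> - 5/2, x near -1 with t in the middle -\<beta> - 1/2, x near
  -1 with t near 1 \<alpha> - \<beta>; t close to x costs 0. Since \<open>jacobi\<close> is a
  definite description, existence and uniqueness of the family have to come before the equation is
  available for it.\<close>

definition jacobi_ode :: "real \<Rightarrow> real \<Rightarrow> real \<Rightarrow> real poly \<Rightarrow> bool" where
  "jacobi_ode \<alpha> \<beta> lam y \<longleftrightarrow>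
     (\<forall>x. (1 - x\<^sup>2) * poly (pderiv (pderiv y)) x
        + (\<beta> - \<alpha> - (\<alpha> + \<beta> + 2) * x) * poly (pderiv y) x + lam * poly y x = 0)"

lemma pderiv_reflect: "pderiv (y \<circ>\<^sub>p [:0, - 1:]) = - (pderiv y \<circ>\<^sub>p [:0, - 1 :: real:])"
  by (simp add: pderiv_pcompose pderiv_pCons)

text \<open>Reflection swaps \<alpha> and \<beta>, so the end point -1 needs no analysis of its own:
  estimates are proved at 1 and transported.\<close>

lemma jacobi_ode_reflect:
  assumes "jacobi_ode \<alpha> \<beta> lam y"
  shows "jacobi_ode \<beta> \<alpha> lam (y \<circ>\<^sub>p [:0, - 1:])"
  unfolding jacobi_ode_def
proof
  fix x
  have "(1 - (-x)\<^sup>2) * poly (pderiv (pderiv y)) (-x)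
        + (\<beta> - \<alpha> - (\<alpha> + \<beta> + 2) * (-x)) * poly (pderiv y) (-x) + lam * poly y (-x) = 0"
    using assms unfolding jacobi_ode_def by blast
  then show "(1 - x\<^sup>2) * poly (pderiv (pderiv (y \<circ>\<^sub>p [:0, - 1:]))) x
        + (\<alpha> - \<beta> - (\<beta> + \<alpha> + 2) * x) * poly (pderiv (y \<circ>\<^sub>p [:0, - 1:])) x
        + lam * poly (y \<circ>\<^sub>p [:0, - 1:]) x = 0"
    by (simp add: pderiv_reflect pderiv_minus poly_pcompose algebra_simps)
qed

section \<open>The boundary layer at the end point 1\<close>

lemma DERIV_nonpos_at_left_end:
  fixes f :: "real \<Rightarrow> real"
  assumes "(f has_real_derivative D) (at x)" "x < b" "\<And>t. x \<le> t \<Longrightarrow> t \<le> b \<Longrightarrow> f t \<le> f x"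
  shows "D \<le> 0"
proof (rule ccontr)
  assume "\<not> D \<le> 0"
  then obtain d where d: "d > 0" "\<And>h. h > 0 \<Longrightarrow> h < d \<Longrightarrow> f x < f (x + h)"
    using DERIV_pos_inc_right[OF assms(1)] by auto
  define h where "h = min (d/2) (b - x)"
  have "h > 0" "h < d" "x + h \<le> b" using d assms(2) by (auto simp: h_def min_def)
  with d(2)[of h] assms(3)[of "x+h"] show False by simp
qed

text \<open>At x = 1 the leading coefficient vanishes and the equation reads 2 (\<alpha> + 1) y'(1)
  = lam y(1). A maximum argument keeps y' at that order in a layer of width of order
  \<open>1 / lam\<close>.\<close>

lemma jacobi_ode_edge:
  assumes ode: "jacobi_ode \<alpha> \<beta> lam y" and al: "\<alpha> > -1" and lam: "lam > 0"
    and de: "0 < \<delta>" "\<delta> \<le> 2" "4 * lam * \<delta> \<le> \<alpha> + 1" "(\<alpha> + \<beta> + 2) * \<delta> \<le> \<alpha> + 1"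
    and be: "\<beta> > -1"
    and x: "x \<in> {1 - \<delta>..1}"
  shows "\<bar>poly y x - poly y 1\<bar> \<le> \<bar>poly y 1\<bar> / 3"
    and "\<bar>poly (pderiv y) x\<bar> \<le> 4 / 3 * lam / (\<alpha> + 1) * \<bar>poly y 1\<bar>"
proof -
  let ?I = "{1 - \<delta>..1}"
  have "compact ?I" "?I \<noteq> {}" using de by auto
  then obtain p where p: "p \<in> ?I" "\<And>t. t \<in> ?I \<Longrightarrow> \<bar>poly y t\<bar> \<le> \<bar>poly y p\<bar>"
  proof -
    have "continuous_on ?I (\<lambda>t. \<bar>poly y t\<bar>)" by (intro continuous_intros)
    from continuous_attains_sup[OF \<open>compact ?I\<close> \<open>?I \<noteq> {}\<close> this] that show ?thesis by blast
  qed
  obtain u where u: "u \<in> ?I" "\<And>t. t \<in> ?I \<Longrightarrow> (poly (pderiv y) t)\<^sup>2 \<le> (poly (pderiv y) u)\<^sup>2"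
  proof -
    have "continuous_on ?I (\<lambda>t. (poly (pderiv y) t)\<^sup>2)" by (intro continuous_intros)
    from continuous_attains_sup[OF \<open>compact ?I\<close> \<open>?I \<noteq> {}\<close> this] that show ?thesis by blast
  qed
  let ?M = "\<bar>poly y p\<bar>" and ?v = "poly (pderiv y) u" and ?w = "poly (pderiv (pderiv y)) u"
  have D0: "1 - u\<^sup>2 \<ge> 0"
    using u(1) de by (simp add: abs_square_le_1 abs_le_iff)
  \<comment> \<open>\<open>y'\<^sup>2\<close> cannot increase to the right of its maximum \<open>u\<close>, and at \<open>u = 1\<close> the factor
    \<open>1 - u\<^sup>2\<close> vanishes; so the equation bounds \<open>y'\<close> by \<open>y\<close> at \<open>u\<close>.\<close>
  have "(1 - u\<^sup>2) * (?v * ?w) \<le> 0"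
  proof (cases "u = 1")
    case False
    then have "u < 1" using u by auto
    have "((\<lambda>t. (poly (pderiv y) t)\<^sup>2) has_real_derivative 2 * ?v * ?w) (at u)"
      by (auto intro!: derivative_eq_intros)
    from DERIV_nonpos_at_left_end[OF this \<open>u < 1\<close>] u have "2 * ?v * ?w \<le> 0" by auto
    then show ?thesis using D0 by (simp add: mult_nonneg_nonpos)
  qed auto
  moreover have "(1 - u\<^sup>2) * ?w = (\<alpha> - \<beta> + (\<alpha> + \<beta> + 2) * u) * ?v - lam * poly y u"
    using ode[unfolded jacobi_ode_def, rule_format, of u] by (simp add: algebra_simps)
  then have "(1 - u\<^sup>2) * ?w * ?v = ((\<alpha> - \<beta> + (\<alpha> + \<beta> + 2) * u) * ?v - lam * poly y u) * ?v" by simp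
  then have "(1 - u\<^sup>2) * (?v * ?w) = (\<alpha> - \<beta> + (\<alpha> + \<beta> + 2) * u) * ?v\<^sup>2 - lam * poly y u * ?v"
    by algebra
  ultimately have "(\<alpha> - \<beta> + (\<alpha> + \<beta> + 2) * u) * ?v\<^sup>2 \<le> lam * poly y u * ?v" by linarith
  \<comment> \<open>The factor \<open>\<alpha> - \<beta> + (\<alpha> + \<beta> + 2) * u\<close>
    equals 2 (\<alpha> + 1) at \<open>u = 1\<close>; the second smallness condition on
    \<open>\<delta>\<close> lets it drop by at most half across the layer.\<close>
  moreover have "(\<alpha> + \<beta> + 2) * (1 - u) \<le> (\<alpha> + \<beta> + 2) * \<delta>"
    using u(1) al be by (intro mult_left_mono) auto
  then have "\<alpha> + 1 \<le> \<alpha> - \<beta> + (\<alpha> + \<beta> + 2) * u" using de(4) by (simp add: algebra_simps)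
  then have "(\<alpha> + 1) * ?v\<^sup>2 \<le> (\<alpha> - \<beta> + (\<alpha> + \<beta> + 2) * u) * ?v\<^sup>2"
    by (rule mult_right_mono) auto
  moreover have "lam * poly y u * ?v \<le> lam * ?M * \<bar>?v\<bar>"
  proof -
    have "poly y u * ?v \<le> \<bar>poly y u\<bar> * \<bar>?v\<bar>" by (metis abs_ge_self abs_mult)
    also have "\<dots> \<le> ?M * \<bar>?v\<bar>" using p(2)[OF u(1)] by (intro mult_right_mono) auto
    finally show ?thesis using lam by (simp add: mult.assoc)
  qed
  ultimately have "(\<alpha> + 1) * \<bar>?v\<bar> * \<bar>?v\<bar> \<le> lam * ?M * \<bar>?v\<bar>"
    by (simp add: power2_eq_square abs_mult_self_eq mult.assoc)
  then have v: "(\<alpha> + 1) * \<bar>?v\<bar> \<le> lam * ?M"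
    using lam by (cases "?v = 0") auto
  have dv: "\<bar>poly (pderiv y) t\<bar> \<le> \<bar>?v\<bar>" if "t \<in> ?I" for t
    using u(2)[OF that] by (simp add: abs_le_square_iff)
  have dy: "\<bar>poly y t - poly y 1\<bar> \<le> \<delta> * \<bar>?v\<bar>" if t: "t \<in> ?I" for t
  proof (cases "t = 1")
    case False
    then have "t < 1" using t by auto
    from poly_MVT[OF this, of y] obtain \<xi> where xi: "t < \<xi>" "\<xi> < 1"
      "poly y 1 - poly y t = (1 - t) * poly (pderiv y) \<xi>" by auto
    have "\<bar>poly y t - poly y 1\<bar> = (1 - t) * \<bar>poly (pderiv y) \<xi>\<bar>"
      using xi \<open>t < 1\<close> by (simp add: abs_minus_commute[of "poly y t"] abs_mult)
    also have "\<dots> \<le> \<delta> * \<bar>?v\<bar>" using t xi dv[of \<xi>] de by (intro mult_mono) auto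
    finally show ?thesis .
  qed (use de in auto)
  \<comment> \<open>The first smallness condition limits the variation of y to a quarter of its
    maximum \<open>?M\<close>. Hence \<open>?M\<close> is at most 4/3 of |y(1)|, and the variation
    at most a third of it.\<close>
  have "4 * lam * \<delta> * \<bar>?v\<bar> \<le> (\<alpha> + 1) * \<bar>?v\<bar>"
    using de(3) by (rule mult_right_mono) auto
  also note v
  finally have "4 * (\<delta> * \<bar>?v\<bar>) \<le> ?M" using lam by (simp add: mult.assoc mult.left_commute)
  moreover have "?M \<le> \<bar>poly y 1\<bar> + \<delta> * \<bar>?v\<bar>" using dy[OF p(1)] by linarith
  ultimately have M: "?M \<le> 4/3 * \<bar>poly y 1\<bar>" "\<delta> * \<bar>?v\<bar> \<le> \<bar>poly y 1\<bar> / 3" by linarith+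
  show "\<bar>poly y x - poly y 1\<bar> \<le> \<bar>poly y 1\<bar> / 3" using dy[OF x] M by linarith
  have "lam * ?M \<le> lam * (4/3 * \<bar>poly y 1\<bar>)" using M lam by (intro mult_left_mono) auto
  with v have "(\<alpha> + 1) * \<bar>?v\<bar> \<le> lam * (4/3 * \<bar>poly y 1\<bar>)" by (rule order_trans)
  then have "\<bar>?v\<bar> * (\<alpha> + 1) \<le> 4/3 * lam * \<bar>poly y 1\<bar>" by (simp add: mult_ac)
  then have "\<bar>?v\<bar> \<le> 4/3 * lam * \<bar>poly y 1\<bar> / (\<alpha> + 1)"
    using al by (subst pos_le_divide_eq) auto
  with dv[OF x] show "\<bar>poly (pderiv y) x\<bar> \<le> 4 / 3 * lam / (\<alpha> + 1) * \<bar>poly y 1\<bar>" by simp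
qed

text \<open>With \<open>x = cos \<theta>\<close> and \<open>u = (1 - x) powr ((\<alpha> + 1/2) / 2) * (1 + x) powr ((\<beta> + 1/2) / 2) * y\<close>
  (the Liouville normal form of the equation), the energy below is
  \<open>(du/d\<theta>)\<^sup>2 + lam * u\<^sup>2\<close>.\<close>

definition energy_slope :: "real \<Rightarrow> real \<Rightarrow> real \<Rightarrow> real" where
  "energy_slope \<alpha> \<beta> x = (\<alpha> - \<beta> + (\<alpha> + \<beta> + 1) * x) / 2"

lemma abs_energy_slope_le:
  assumes "\<bar>x\<bar> \<le> 1"
  shows "\<bar>energy_slope \<alpha> \<beta> x\<bar> \<le> \<bar>\<alpha> - \<beta>\<bar> + \<bar>\<alpha> + \<beta> + 1\<bar>"
proof -
  have "\<bar>\<alpha> - \<beta> + (\<alpha> + \<beta> + 1) * x\<bar> \<le> \<bar>\<alpha> - \<beta>\<bar> + \<bar>(\<alpha> + \<beta> + 1) * x\<bar>"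
    by (rule abs_triangle_ineq)
  also have "\<dots> \<le> \<bar>\<alpha> - \<beta>\<bar> + \<bar>\<alpha> + \<beta> + 1\<bar> * 1"
    unfolding abs_mult using assms by (intro add_left_mono mult_left_mono) auto
  finally have "\<bar>\<alpha> - \<beta> + (\<alpha> + \<beta> + 1) * x\<bar> / 2 \<le> (\<bar>\<alpha> - \<beta>\<bar> + \<bar>\<alpha> + \<beta> + 1\<bar>) / 2"
    by (intro divide_right_mono) auto
  also have "\<dots> \<le> \<bar>\<alpha> - \<beta>\<bar> + \<bar>\<alpha> + \<beta> + 1\<bar>" by simp
  finally show ?thesis by (simp add: energy_slope_def)
qed

text \<open>Write u = g y, where g^2 is the leading product of powers. \<open>energy_slope\<close>
  is minus (1 - x^2) times the logarithmic derivative of g, so (1 - x^2) du/dx = g ((1 - x^2) y' -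
  \<open>energy_slope\<close> y), and (du/d\<theta>)^2 = (1 - x^2) (du/dx)^2.\<close>

definition energy :: "real \<Rightarrow> real \<Rightarrow> real \<Rightarrow> real poly \<Rightarrow> real \<Rightarrow> real" where
  "energy \<alpha> \<beta> lam y x = (1 - x) powr (\<alpha> + 1/2) * (1 + x) powr (\<beta> + 1/2) *
     (((1 - x\<^sup>2) * poly (pderiv y) x - energy_slope \<alpha> \<beta> x * poly y x)\<^sup>2 / (1 - x\<^sup>2)
       + lam * (poly y x)\<^sup>2)"

text \<open>At \<open>x = 0\<close> both sides refer to the same point, so one number, the energy at
  0, sets the scale at both ends.\<close>

lemma energy_reflect:
  "energy \<beta> \<alpha> lam (y \<circ>\<^sub>p [:0, - 1:]) x = energy \<alpha> \<beta> lam y (- x)"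
proof -
  have *: "energy_slope \<beta> \<alpha> x = - energy_slope \<alpha> \<beta> (- x)"
    by (simp add: energy_slope_def field_simps)
  have "((1 - x\<^sup>2) * poly (pderiv (y \<circ>\<^sub>p [:0, - 1:])) x
      - energy_slope \<beta> \<alpha> x * poly (y \<circ>\<^sub>p [:0, - 1:]) x)\<^sup>2
     = ((1 - (- x)\<^sup>2) * poly (pderiv y) (- x) - energy_slope \<alpha> \<beta> (- x) * poly y (- x))\<^sup>2"
    by (simp add: * pderiv_reflect poly_pcompose power2_commute)
  then show ?thesis unfolding energy_def by (simp add: poly_pcompose mult_ac)
qed

text \<open>In \<theta> the normal form is u'' + (lam + perturbation) u = 0, where the perturbation
  is of order 1 / (1 - x^2) and independent of lam. Differentiating u'^2 + lam u^2 therefore leaves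
  only a multiple of u u': the terms with lam or \<open>z\<^sup>2\<close> cancel.\<close>

lemma energy_has_derivative:
  assumes ode: "jacobi_ode \<alpha> \<beta> lam y" and x: "-1 < x" "x < 1"
  defines "z \<equiv> (1 - x\<^sup>2) * poly (pderiv y) x - energy_slope \<alpha> \<beta> x * poly y x"
  shows "(energy \<alpha> \<beta> lam y has_real_derivative
     (1 - x) powr (\<alpha> + 1/2) * (1 + x) powr (\<beta> + 1/2) *
       (2 * poly y x * z / (1 - x\<^sup>2) * (energy_slope \<alpha> \<beta> x * (energy_slope \<alpha> \<beta> x - x) / (1 - x\<^sup>2)
         - (\<alpha> + \<beta> + 1) / 2))) (at x)"
proof -
  define D where "D = 1 - x\<^sup>2"
  have D: "D > 0" using x by (simp add: D_def abs_square_less_1 abs_less_iff)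
  define r where "r = energy_slope \<alpha> \<beta> x"
  define y0 y1 y2 where "y0 = poly y x" and "y1 = poly (pderiv y) x" and "y2 = poly (pderiv (pderiv y)) x"
  define ga gb where "ga = (1 - x) powr (\<alpha> + 1/2)" and "gb = (1 + x) powr (\<beta> + 1/2)"
  have o: "D * y2 = (2 * r + x) * y1 - lam * y0"
  proof -
    have "2 * r + x = - (\<beta> - \<alpha> - (\<alpha> + \<beta> + 2) * x)"
      by (simp add: r_def energy_slope_def field_simps)
    then show ?thesis using ode[unfolded jacobi_ode_def, rule_format, of x]
      unfolding D_def y0_def y1_def y2_def by (simp only: minus_mult_left[symmetric])
  qed
  have z: "z = D * y1 - r * y0" by (simp add: z_def D_def y1_def r_def y0_def)
  have g: "((\<lambda>x. (1 - x) powr (\<alpha> + 1/2) * (1 + x) powr (\<beta> + 1/2)) has_real_derivative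
      ga * gb * (- 2 * r / D)) (at x)"
  proof -
    define p q where "p = - (\<alpha> + 1/2) / (1 - x)" and "q = (\<beta> + 1/2) / (1 + x)"
    have pd: "((\<lambda>x. u x powr s) has_real_derivative u x powr s * (s * d / u x)) (at x)"
      if "(u has_real_derivative d) (at x)" "u x > 0" for u :: "real \<Rightarrow> real" and s d
      using DERIV_fun_powr[OF that, of s] that(2) by (simp add: powr_diff mult_ac)
    have "((\<lambda>x. (1 - x) powr (\<alpha> + 1/2)) has_real_derivative ga * ((\<alpha> + 1/2) * (- 1) / (1 - x))) (at x)"
      unfolding ga_def using x by (intro pd) (auto intro!: derivative_eq_intros)
    then have "((\<lambda>x. (1 - x) powr (\<alpha> + 1/2)) has_real_derivative ga * p) (at x)"
      by (simp add: p_def)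
    moreover have "((\<lambda>x. (1 + x) powr (\<beta> + 1/2)) has_real_derivative gb * ((\<beta> + 1/2) * 1 / (1 + x))) (at x)"
      unfolding gb_def using x by (intro pd) (auto intro!: derivative_eq_intros)
    then have "((\<lambda>x. (1 + x) powr (\<beta> + 1/2)) has_real_derivative gb * q) (at x)"
      by (simp add: q_def)
    ultimately have "((\<lambda>x. (1 - x) powr (\<alpha> + 1/2) * (1 + x) powr (\<beta> + 1/2)) has_real_derivative
      ga * p * gb + gb * q * ga) (at x)"
      using DERIV_mult unfolding ga_def gb_def by blast
    moreover have "p + q = - 2 * r / D"
    proof -
      have "D = (1 - x) * (1 + x)" by (simp add: D_def power2_eq_square algebra_simps)
      moreover have "- 2 * r = - (\<alpha> + 1/2) * (1 + x) + (\<beta> + 1/2) * (1 - x)"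
        by (simp add: r_def energy_slope_def field_simps)
      moreover have "p + q = (- (\<alpha> + 1/2) * (1 + x) + (\<beta> + 1/2) * (1 - x)) / ((1 - x) * (1 + x))"
        unfolding p_def q_def using x by (subst add_frac_eq) auto
      ultimately show ?thesis by simp
    qed
    moreover have "ga * p * gb + gb * q * ga = ga * gb * (p + q)" by algebra
    ultimately show ?thesis by simp
  qed
  have dz: "((\<lambda>x. (1 - x\<^sup>2) * poly (pderiv y) x - energy_slope \<alpha> \<beta> x * poly y x) has_real_derivative
      (r - x) * y1 - (lam + (\<alpha> + \<beta> + 1)/2) * y0) (at x)"
  proof -
    have "((\<lambda>x. (1 - x\<^sup>2) * poly (pderiv y) x - energy_slope \<alpha> \<beta> x * poly y x) has_real_derivative
      D * y2 - 2 * x * y1 - ((\<alpha> + \<beta> + 1)/2 * y0 + r * y1)) (at x)"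
      unfolding energy_slope_def D_def y0_def y1_def y2_def r_def
      by (auto intro!: derivative_eq_intros simp: field_simps)
    then show ?thesis unfolding o by (simp add: algebra_simps)
  qed
  have inner: "((\<lambda>x. ((1 - x\<^sup>2) * poly (pderiv y) x - energy_slope \<alpha> \<beta> x * poly y x)\<^sup>2 / (1 - x\<^sup>2)
       + lam * (poly y x)\<^sup>2) has_real_derivative
       (2 * z * ((r - x) * y1 - (lam + (\<alpha> + \<beta> + 1)/2) * y0) * D + z\<^sup>2 * (2 * x)) / D\<^sup>2
         + lam * (2 * y0 * y1)) (at x)"
  proof -
    define Z where "Z x = (1 - x\<^sup>2) * poly (pderiv y) x - energy_slope \<alpha> \<beta> x * poly y x" for x
    have Z: "(Z has_real_derivative (r - x) * y1 - (lam + (\<alpha> + \<beta> + 1)/2) * y0) (at x)" "Z x = z"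
      using dz by (simp_all add: Z_def[abs_def] z_def)
    have "((\<lambda>x. (Z x)\<^sup>2 / (1 - x\<^sup>2) + lam * (poly y x)\<^sup>2) has_real_derivative
       (2 * z * ((r - x) * y1 - (lam + (\<alpha> + \<beta> + 1)/2) * y0) * D + z\<^sup>2 * (2 * x)) / D\<^sup>2
         + lam * (2 * y0 * y1)) (at x)"
      unfolding D_def using D Z(2)
      by (auto intro!: derivative_eq_intros Z(1) simp: y0_def y1_def D_def power2_eq_square)
    then show ?thesis by (simp add: Z_def)
  qed
  have y1: "y1 = (z + r * y0) / D" using z D by (simp add: field_simps)
  have eq: "ga * gb * (- 2 * r / D) * (z\<^sup>2 / D + lam * y0\<^sup>2) +
      ((2 * z * ((r - x) * y1 - (lam + (\<alpha> + \<beta> + 1)/2) * y0) * D + z\<^sup>2 * (2 * x)) / D\<^sup>2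
         + lam * (2 * y0 * y1)) * (ga * gb)
     = ga * gb * (2 * y0 * z / D * (r * (r - x) / D - (\<alpha> + \<beta> + 1) / 2))"
    unfolding y1 using D by (simp add: field_simps power2_eq_square)
  have "(energy \<alpha> \<beta> lam y has_real_derivative ga * gb * (- 2 * r / D) * (z\<^sup>2 / D + lam * y0\<^sup>2) +
      ((2 * z * ((r - x) * y1 - (lam + (\<alpha> + \<beta> + 1)/2) * y0) * D + z\<^sup>2 * (2 * x)) / D\<^sup>2
         + lam * (2 * y0 * y1)) * (ga * gb)) (at x)"
    unfolding energy_def using DERIV_mult[OF g inner] by (simp add: z_def y0_def r_def D_def ga_def gb_def)
  then show ?thesis unfolding eq by (simp add: ga_def gb_def y0_def D_def r_def)
qed


text \<open>A Gronwall inequality; \<open>T\<close> is cot \<theta> for x = cos \<theta>. Taking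
  both absolute values makes the bound independent of the order of the two points. The exponent
  stays bounded as long as both keep at least a fixed multiple of \<open>1 / lam\<close> away from 1
  and -1.\<close>

lemma energy_comparable:
  assumes ode: "jacobi_ode \<alpha> \<beta> lam y" and lam: "lam > 0"
    and x: "\<bar>x\<bar> < 1" and x': "\<bar>x'\<bar> < 1"
  defines "\<kappa> \<equiv> (\<bar>\<alpha> - \<beta>\<bar> + \<bar>\<alpha> + \<beta> + 1\<bar> + 1)\<^sup>2 / sqrt lam"
    and "T \<equiv> \<lambda>x. x / sqrt (1 - x\<^sup>2)"
  shows "energy \<alpha> \<beta> lam y x \<le> energy \<alpha> \<beta> lam y x' * exp (\<kappa> * (\<bar>T x\<bar> + \<bar>T x'\<bar>))"
proof -
  define K where "K = (\<bar>\<alpha> - \<beta>\<bar> + \<bar>\<alpha> + \<beta> + 1\<bar> + 1)\<^sup>2"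
  have \<kappa>: "\<kappa> = K / sqrt lam" "\<kappa> \<ge> 0" using lam by (simp_all add: K_def \<kappa>_def)
  let ?E = "energy \<alpha> \<beta> lam y"
  have E0: "?E t \<ge> 0" if "\<bar>t\<bar> < 1" for t
    using that lam unfolding energy_def
    by (intro mult_nonneg_nonneg add_nonneg_nonneg divide_nonneg_nonneg)
       (auto simp: abs_square_le_1)
  have deriv: "\<exists>E'. (?E has_real_derivative E') (at t) \<and>
      \<bar>E'\<bar> \<le> \<kappa> * (1 / ((1 - t\<^sup>2) * sqrt (1 - t\<^sup>2))) * ?E t" if t: "\<bar>t\<bar> < 1" for t
  proof -
    define D where "D = 1 - t\<^sup>2"
    have D: "D > 0" "D \<le> 1" using t by (simp_all add: D_def abs_square_less_1)
    define r where "r = energy_slope \<alpha> \<beta> t"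
    define z where "z = D * poly (pderiv y) t - r * poly y t"
    define g where "g = (1 - t) powr (\<alpha> + 1/2) * (1 + t) powr (\<beta> + 1/2)"
    define q where "q = r * (r - t) / D - (\<alpha> + \<beta> + 1) / 2"
    define R where "R = \<bar>\<alpha> - \<beta>\<bar> + \<bar>\<alpha> + \<beta> + 1\<bar>"
    have r: "\<bar>r\<bar> \<le> R" unfolding r_def R_def using t by (intro abs_energy_slope_le) auto
    \<comment> \<open>Multiplied by \<open>D\<close> the perturbation is bounded;
      \<open>R * (R + 1) + R \<le> (R + 1)^2\<close> is the origin of \<open>K\<close>.\<close>
    have "\<bar>D * q\<bar> \<le> K"
    proof -
      have "D * q = r * (r - t) - D * ((\<alpha> + \<beta> + 1) / 2)" using D by (simp add: q_def field_simps)
      moreover have "\<bar>r * (r - t)\<bar> \<le> R * (R + 1)"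
        unfolding abs_mult using r t by (intro mult_mono) auto
      moreover have "\<bar>D * ((\<alpha> + \<beta> + 1) / 2)\<bar> \<le> 1 * R"
        unfolding abs_mult using D by (intro mult_mono) (auto simp: R_def)
      ultimately have "\<bar>D * q\<bar> \<le> R * (R + 1) + R" by linarith
      also have "\<dots> \<le> K" unfolding K_def R_def[symmetric] by (simp add: power2_eq_square algebra_simps)
      finally show ?thesis .
    qed
    then have q: "\<bar>q\<bar> \<le> K / D" using D by (simp add: abs_mult field_simps)
    define E' where "E' = g * (2 * poly y t * z / D * q)"
    have "(?E has_real_derivative E') (at t)"
      using energy_has_derivative[OF ode, of t] t
      by (simp add: E'_def g_def q_def z_def r_def D_def abs_less_iff)
    moreover have "\<bar>E'\<bar> \<le> \<kappa> * (1 / (D * sqrt D)) * ?E t"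
    proof -
      \<comment> \<open>The arithmetic-geometric mean of the two terms of the energy gains the
        factor \<open>1 / sqrt lam\<close>.\<close>
      have "2 * (sqrt lam * \<bar>poly y t\<bar>) * (\<bar>z\<bar> / sqrt D) \<le> (sqrt lam * \<bar>poly y t\<bar>)\<^sup>2 + (\<bar>z\<bar> / sqrt D)\<^sup>2"
        using sum_squares_bound by blast
      also have "\<dots> = z\<^sup>2 / D + lam * (poly y t)\<^sup>2"
        using D lam by (simp add: power_mult_distrib power_divide)
      finally have "2 * \<bar>poly y t\<bar> * \<bar>z\<bar> * (sqrt lam / sqrt D) \<le> z\<^sup>2 / D + lam * (poly y t)\<^sup>2" by (simp add: field_simps)
      then have a: "2 * \<bar>poly y t\<bar> * \<bar>z\<bar> \<le> (z\<^sup>2 / D + lam * (poly y t)\<^sup>2) * (sqrt D / sqrt lam)"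
        using D lam by (simp add: field_simps)
      have g: "g \<ge> 0" by (simp add: g_def)
      have "\<bar>E'\<bar> = g * ((2 * \<bar>poly y t\<bar> * \<bar>z\<bar>) / D * \<bar>q\<bar>)"
        using D g by (simp add: E'_def abs_mult)
      also have "\<dots> \<le> g * ((z\<^sup>2 / D + lam * (poly y t)\<^sup>2) * (sqrt D / sqrt lam) / D * (K / D))"
        using a q D g lam by (intro mult_left_mono[of _ _ g] mult_mono[of _ _ "\<bar>q\<bar>"] divide_right_mono) auto
      also have "\<dots> = \<kappa> * (1 / (D * sqrt D)) * ?E t"
      proof -
        have "sqrt D / (D * D) = 1 / (D * sqrt D)"
          using D by (simp add: field_simps)
        moreover have "g * ((z\<^sup>2 / D + lam * (poly y t)\<^sup>2) * (sqrt D / sqrt lam) / D * (K / D))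
          = K / sqrt lam * (sqrt D / (D * D)) * (g * (z\<^sup>2 / D + lam * (poly y t)\<^sup>2))"
          by (simp add: divide_inverse mult_ac)
        ultimately show ?thesis
          unfolding \<kappa>(1) by (simp add: energy_def g_def z_def D_def r_def)
      qed
      finally show ?thesis .
    qed
    ultimately show ?thesis by (auto simp: D_def)
  qed
  have dT: "(T has_real_derivative 1 / ((1 - t\<^sup>2) * sqrt (1 - t\<^sup>2))) (at t)" if t: "\<bar>t\<bar> < 1" for t
  proof -
    have D: "1 - t\<^sup>2 > 0" using t by (simp add: abs_square_less_1)
    have "(T has_real_derivative (sqrt (1 - t\<^sup>2) - t * (- 2 * t * (inverse (sqrt (1 - t\<^sup>2)) / 2))) / (1 - t\<^sup>2)) (at t)"
      unfolding T_def using D by (auto intro!: derivative_eq_intros)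
    moreover have "(sqrt (1 - t\<^sup>2) - t * (- 2 * t * (inverse (sqrt (1 - t\<^sup>2)) / 2))) = 1 / sqrt (1 - t\<^sup>2)"
    proof -
      have "sqrt (1 - t\<^sup>2) * sqrt (1 - t\<^sup>2) = 1 - t\<^sup>2" using D by simp
      then show ?thesis using D by (simp add: field_simps power2_eq_square)
    qed
    ultimately show ?thesis by (simp add: mult.commute)
  qed
  \<comment> \<open>Since \<open>|E'| \<le> \<kappa> T' E\<close>, both \<open>E exp(\<kappa> T)\<close> and \<open>- E exp(- \<kappa> T)\<close> are nondecreasing.\<close>
  have mono: "u \<le> v \<Longrightarrow> ?E u * exp (\<sigma> * \<kappa> * T u) * \<sigma> \<le> ?E v * exp (\<sigma> * \<kappa> * T v) * \<sigma>"
    if \<sigma>: "\<sigma> = 1 \<or> \<sigma> = -1" and u: "\<bar>u\<bar> < 1" and v: "\<bar>v\<bar> < 1" for \<sigma> u v :: real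
  proof (rule DERIV_nonneg_imp_nondecreasing[of u v "\<lambda>t. ?E t * exp (\<sigma> * \<kappa> * T t) * \<sigma>"])
    fix t assume "u \<le> t" "t \<le> v"
    then have t: "\<bar>t\<bar> < 1" using u v by auto
    obtain E' where E': "(?E has_real_derivative E') (at t)"
      "\<bar>E'\<bar> \<le> \<kappa> * (1 / ((1 - t\<^sup>2) * sqrt (1 - t\<^sup>2))) * ?E t" using deriv[OF t] by blast
    let ?d = "(E' + ?E t * (\<sigma> * \<kappa> * (1 / ((1 - t\<^sup>2) * sqrt (1 - t\<^sup>2))))) * exp (\<sigma> * \<kappa> * T t) * \<sigma>"
    have "((\<lambda>t. ?E t * exp (\<sigma> * \<kappa> * T t) * \<sigma>) has_real_derivative ?d) (at t)"
      by (rule derivative_eq_intros E'(1) dT[OF t] refl)+ (simp add: algebra_simps)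
    moreover have "?d \<ge> 0"
    proof -
      have "?d = exp (\<sigma> * \<kappa> * T t) * (\<sigma> * E' + \<kappa> * (1 / ((1 - t\<^sup>2) * sqrt (1 - t\<^sup>2))) * ?E t)"
        using \<sigma> by (auto simp: algebra_simps)
      moreover have "\<sigma> * E' \<ge> - \<bar>E'\<bar>" using \<sigma> by auto
      then have "\<sigma> * E' + \<kappa> * (1 / ((1 - t\<^sup>2) * sqrt (1 - t\<^sup>2))) * ?E t \<ge> 0" using E'(2) by linarith
      ultimately show ?thesis by (metis exp_ge_zero mult_nonneg_nonneg)
    qed
    ultimately show "\<exists>d. ((\<lambda>t. ?E t * exp (\<sigma> * \<kappa> * T t) * \<sigma>) has_real_derivative d) (at t) \<and> 0 \<le> d" by blast
  qed
  have "\<exists>\<sigma>. (\<sigma> = 1 \<or> \<sigma> = -1) \<and> ?E x * exp (\<sigma> * \<kappa> * T x) \<le> ?E x' * exp (\<sigma> * \<kappa> * T x')"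
    using mono[of 1 x x'] mono[of "-1" x' x] x x' by (cases "x \<le> x'") (auto intro: exI[of _ 1] exI[of _ "-1"])
  then obtain \<sigma> :: real where \<sigma>: "\<sigma> = 1 \<or> \<sigma> = -1"
    and le: "?E x * exp (\<sigma> * \<kappa> * T x) \<le> ?E x' * exp (\<sigma> * \<kappa> * T x')" by blast
  have "?E x = ?E x * exp (\<sigma> * \<kappa> * T x) * exp (- (\<sigma> * \<kappa> * T x))"
    by (simp add: mult.assoc exp_minus)
  also have "\<dots> \<le> ?E x' * exp (\<sigma> * \<kappa> * T x') * exp (- (\<sigma> * \<kappa> * T x))"
    using le by (rule mult_right_mono) simp
  also have "\<dots> = ?E x' * exp (\<kappa> * (\<sigma> * T x' - \<sigma> * T x))"
    by (simp add: exp_add[symmetric] algebra_simps exp_diff exp_minus divide_inverse)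
  also have "\<dots> \<le> ?E x' * exp (\<kappa> * (\<bar>T x\<bar> + \<bar>T x'\<bar>))"
    using E0[OF x'] \<kappa>(2) \<sigma> by (intro mult_left_mono exp_mono mult_left_mono) auto
  finally show ?thesis .
qed

lemma powr_le_powr_of_comparable:
  fixes u v k p :: real
  assumes "0 < u" "0 < v" "1 \<le> k" "u \<le> k * v" "v \<le> k * u"
  shows "u powr p \<le> k powr \<bar>p\<bar> * v powr p"
proof (cases "p \<ge> 0")
  case True
  then have "u powr p \<le> (k * v) powr p" using assms by (intro powr_mono2) auto
  then show ?thesis using True assms by (simp add: powr_mult)
next
  case False
  then have "u powr p \<le> (v / k) powr p"
    using assms by (intro powr_mono2') (auto simp: field_simps)
  also have "\<dots> = v powr p / k powr p" using assms by (simp add: powr_divide)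
  finally show ?thesis using False assms by (simp add: powr_minus divide_inverse mult.commute)
qed

section \<open>Bounds for solutions near an end point\<close>

text \<open>Meant for \<open>a = \<alpha> + 1/2\<close> and \<open>S\<close> the energy at 0. With
  the shift \<open>1 / lam\<close> the powers behave like those of 1 - x away from 1 and freeze in
  the boundary layer. The clauses for roots serve the denominators of Lagrange polynomials at
  interior nodes; the final clause, after reflection, serves the node -1.\<close>

definition edge_bounds :: "real \<Rightarrow> real \<Rightarrow> real \<Rightarrow> real \<Rightarrow> real poly \<Rightarrow> bool" where
  "edge_bounds C a S lam y \<longleftrightarrow>
     (\<forall>x\<in>{0..1}.
        lam * (poly y x)\<^sup>2 \<le> C * S * (1 - x + 1 / lam) powr - a \<and>
        (poly (pderiv y) x)\<^sup>2 \<le> C * S * (1 - x + 1 / lam) powr (- a - 1) \<and>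
        (poly y x = 0 \<and> S > 0 \<longrightarrow>
           S * (1 - x + 1 / lam) powr (- a - 1) \<le> C * (poly (pderiv y) x)\<^sup>2 \<and>
           1 - x + 1 / lam \<le> C * (1 - x))) \<and>
     S * lam powr (a - 1) \<le> C * (poly y 1)\<^sup>2"

lemma edge_bounds_mono:
  assumes "edge_bounds C a S lam y" "C \<le> C'" "S \<ge> 0"
  shows "edge_bounds C' a S lam y"
proof -
  have m: "C * S * u powr p \<le> C' * S * u powr p" for u p
    using assms by (intro mult_right_mono) auto
  have m2: "C * v\<^sup>2 \<le> C' * v\<^sup>2" for v using assms by (intro mult_right_mono) auto
  have m3: "C * (1 - x) \<le> C' * (1 - x)" if "x \<in> {0..1}" for x
    using assms that by (intro mult_right_mono) auto
  show ?thesis using assms(1) unfolding edge_bounds_def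
    by (meson m m2 m3 order_trans)
qed

lemma sum_square_le: "((p::real) + q)\<^sup>2 \<le> 2 * p\<^sup>2 + 2 * q\<^sup>2"
  using sum_squares_bound[of p q] by (simp add: power2_sum)

text \<open>Energy comparison works up to \<open>1 - \<delta>\<close> with
  \<open>\<delta> = \<epsilon> / lam\<close>, the layer estimate beyond it. Both hold at
  \<open>1 - \<delta>\<close>, where the energy is converted into y(1) and back. All constants are
  fixed before lam and y.\<close>

lemma jacobi_ode_edge_bounds:
  assumes al: "\<alpha> > -1" and be: "\<beta> > -1"
  shows "\<exists>C lam0. C \<ge> 1 \<and> lam0 \<ge> 1 \<and> (\<forall>lam\<ge>lam0. \<forall>y. jacobi_ode \<alpha> \<beta> lam y \<longrightarrow>
    edge_bounds C (\<alpha> + 1/2) (energy \<alpha> \<beta> lam y 0) lam y)"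
proof -
  define a where "a = \<alpha> + 1/2"
  define \<epsilon> where "\<epsilon> = min ((\<alpha> + 1) / 4) 1"
  have eps: "0 < \<epsilon>" "\<epsilon> \<le> 1" "4 * \<epsilon> \<le> \<alpha> + 1" using al by (auto simp: \<epsilon>_def min_def)
  \<comment> \<open>The 2 gives \<open>\<delta> \<le> 1/2\<close>; the quotient gives the second
    smallness condition of \<open>jacobi_ode_edge\<close>. The first one is built into
    \<open>\<epsilon>\<close>.\<close>
  define lam0 where "lam0 = max 2 ((\<alpha> + \<beta> + 2) / (\<alpha> + 1))"
  \<comment> \<open>Since \<open>1 / lam = (k - 1) * \<delta>\<close>, the shift changes a distance
    \<open>1 - x \<ge> \<delta>\<close> by at most the factor \<open>k\<close>.\<close>
  define k where "k = 1 + 1 / \<epsilon>"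
  have k: "k \<ge> 1" "k * \<epsilon> = 1 + \<epsilon>" "1 / \<epsilon> \<le> k" using eps by (auto simp: k_def field_simps)
  define R where "R = \<bar>\<alpha> - \<beta>\<bar> + \<bar>\<alpha> + \<beta> + 1\<bar>"
  define CE where "CE = exp ((R + 1)\<^sup>2 / sqrt \<epsilon>)"
  have CE: "CE \<ge> 1" using eps by (simp add: CE_def)
  define G where "G = 2 powr \<bar>\<beta> + 1/2\<bar>"
  have G: "G \<ge> 1" by (simp add: G_def ge_one_powr_ge_zero)
  define c where "c = 4 / 3 / (\<alpha> + 1)"
  have c: "c > 0" using al by (simp add: c_def)
  define C4 where "C4 = 4 * c\<^sup>2 + 4 * R\<^sup>2 / \<epsilon> + 2"
  have C4: "C4 \<ge> 0" using eps by (simp add: C4_def)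
  define P1 where "P1 = 4 * G * CE * k powr \<bar>- a\<bar>"
  define P2 where "P2 = (2 * G * CE * (1 + R\<^sup>2 / \<epsilon>) + c\<^sup>2 * (4 * G * CE)) * k powr \<bar>- a - 1\<bar>"
  define P3 where "P3 = 2 * G * CE * k powr \<bar>- a - 1\<bar>"
  define P4 where "P4 = CE * G * C4 * \<epsilon> powr a"
  have P: "P1 \<ge> 0" "P2 \<ge> 0" "P3 \<ge> 0" "P4 \<ge> 0"
    using CE G C4 eps by (auto simp: P1_def P2_def P3_def P4_def)
  define C where "C = 1 + P1 + P2 + P3 + P4 + k"
  have C: "C \<ge> 1" "C \<ge> P1" "C \<ge> P2" "C \<ge> P3" "C \<ge> P4" "C \<ge> k" using P k by (auto simp: C_def)
  have main: "edge_bounds C a (energy \<alpha> \<beta> lam y 0) lam y"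
    if lam: "lam \<ge> lam0" and ode: "jacobi_ode \<alpha> \<beta> lam y" for lam y
  proof -
    define S where "S = energy \<alpha> \<beta> lam y 0"
    have l: "lam \<ge> 2" "lam \<ge> (\<alpha> + \<beta> + 2) / (\<alpha> + 1)" using lam by (auto simp: lam0_def)
    have S0: "S \<ge> 0" using l by (simp add: S_def energy_def)
    define \<delta> where "\<delta> = \<epsilon> / lam"
    have de: "0 < \<delta>" "\<delta> \<le> 1/2" "lam * \<delta> = \<epsilon>" using l eps by (auto simp: \<delta>_def field_simps)
    have de': "4 * lam * \<delta> \<le> \<alpha> + 1" "(\<alpha> + \<beta> + 2) * \<delta> \<le> \<alpha> + 1"
    proof -
      show "4 * lam * \<delta> \<le> \<alpha> + 1" using de eps by simp
      have "(\<alpha> + \<beta> + 2) * \<epsilon> \<le> (\<alpha> + \<beta> + 2) * 1" using al be eps by (intro mult_left_mono) auto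
      also have "\<dots> \<le> (\<alpha> + 1) * lam" using l(2) al by (simp add: field_simps)
      finally show "(\<alpha> + \<beta> + 2) * \<delta> \<le> \<alpha> + 1" using l by (simp add: \<delta>_def field_simps)
    qed
    note edge = jacobi_ode_edge[OF ode al _ de(1) _ de' be]
    define A where "A x = 1 - x + 1 / lam" for x
    define Y where "Y = (poly y 1)\<^sup>2"
    let ?y = "poly y" and ?y' = "poly (pderiv y)"
    have pw: "u powr p \<le> k powr \<bar>p\<bar> * A x powr p"
      if "(u = 1 - x \<and> x \<in> {0..1 - \<delta>}) \<or> (u = \<delta> \<and> x \<in> {1 - \<delta>..1})" for u x p
    proof (rule powr_le_powr_of_comparable)
      have ke: "k * \<delta> = \<delta> + 1 / lam" using de k l by (simp add: \<delta>_def field_simps)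
      have kk: "w \<le> k * w" if "w \<ge> 0" for w using k that mult_right_mono[of 1 k w] by auto
      show "0 < u" "0 < A x" "1 \<le> k" using that de l k by (auto simp: A_def add_nonneg_pos)
      show "u \<le> k * A x"
      proof -
        have "u \<le> A x"
        proof -
          have "\<delta> \<le> 1 / lam" using eps l by (simp add: \<delta>_def divide_right_mono)
          then show ?thesis using that l by (auto simp: A_def)
        qed
        also have "\<dots> \<le> k * A x" using \<open>0 < A x\<close> by (intro kk) auto
        finally show ?thesis .
      qed
      show "A x \<le> k * u"
      proof (cases "u = \<delta> \<and> x \<in> {1 - \<delta>..1}")
        case True then show ?thesis using ke by (auto simp: A_def)
      next
        case False
        then have u: "u = 1 - x" "u \<ge> \<delta>" using that by auto
        have "1 / lam = (k - 1) * \<delta>" using ke by (simp add: algebra_simps)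
        also have "\<dots> \<le> (k - 1) * u" using u k by (intro mult_left_mono) auto
        finally have "1 / lam \<le> (k - 1) * u" .
        moreover have "k * u = (k - 1) * u + u" by (simp add: algebra_simps)
        ultimately show ?thesis unfolding A_def using u(1) by linarith
      qed
    qed
    have rb: "(energy_slope \<alpha> \<beta> x)\<^sup>2 \<le> R\<^sup>2" if "x \<in> {0..1}" for x
    proof -
      have "\<bar>energy_slope \<alpha> \<beta> x\<bar> \<le> R"
        unfolding R_def using that by (intro abs_energy_slope_le) auto
      then show ?thesis using abs_le_square_iff by fastforce
    qed
    define D where "D x = 1 - x\<^sup>2" for x :: real
    define z where "z x = D x * ?y' x - energy_slope \<alpha> \<beta> x * ?y x" for x
    define w where "w x = (1 - x) powr a * (1 + x) powr (\<beta> + 1/2)" for x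
    have E: "energy \<alpha> \<beta> lam y x = w x * ((z x)\<^sup>2 / D x + lam * (?y x)\<^sup>2)" for x
      by (simp add: energy_def w_def z_def D_def a_def)
    have bulk: "1 - x \<le> D x" "D x \<le> 2 * (1 - x)" "w x \<le> G * (1 - x) powr a" "(1 - x) powr a \<le> G * w x"
        "energy \<alpha> \<beta> lam y x \<le> CE * S" "S \<le> CE * energy \<alpha> \<beta> lam y x"
      if x: "x \<in> {0..1 - \<delta>}" for x
    proof -
      have x1: "0 \<le> x" "x < 1" "1 - x \<ge> \<delta>" using x de by auto
      have Dx: "D x = (1 - x) * (1 + x)" by (simp add: D_def power2_eq_square algebra_simps)
      have "(1 - x) * 1 \<le> (1 - x) * (1 + x)" "(1 - x) * (1 + x) \<le> (1 - x) * 2"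
        using x1 by (intro mult_left_mono; simp)+
      then show D1: "1 - x \<le> D x" "D x \<le> 2 * (1 - x)" unfolding Dx by auto
      have "(1 + x) powr (\<beta> + 1/2) \<le> G" "1 \<le> G * (1 + x) powr (\<beta> + 1/2)"
        using powr_le_powr_of_comparable[of "1 + x" 1 2 "\<beta> + 1/2"]
          powr_le_powr_of_comparable[of 1 "1 + x" 2 "\<beta> + 1/2"] x1 by (auto simp: G_def)
      then have "(1 - x) powr a * (1 + x) powr (\<beta> + 1/2) \<le> (1 - x) powr a * G"
        "(1 - x) powr a * 1 \<le> (1 - x) powr a * (G * (1 + x) powr (\<beta> + 1/2))"
        by (intro mult_left_mono; simp)+
      then show "w x \<le> G * (1 - x) powr a" "(1 - x) powr a \<le> G * w x"
        by (auto simp: w_def mult_ac)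
      have Dp: "D x > 0" "D x \<ge> \<delta>" using D1 x1 de by linarith+
      \<comment> \<open>As \<open>lam * \<delta> = \<epsilon>\<close>, the exponent of
        \<open>energy_comparable\<close> is bounded independently of lam, which makes
        \<open>CE\<close> a constant.\<close>
      have "\<bar>x / sqrt (D x)\<bar> \<le> 1 / sqrt \<delta>"
        using x1 Dp de by (simp add: abs_mult) (intro frac_le; simp)
      moreover have "sqrt lam * sqrt \<delta> = sqrt \<epsilon>" using de l by (simp add: real_sqrt_mult[symmetric])
      ultimately have "(R + 1)\<^sup>2 / sqrt lam * \<bar>x / sqrt (D x)\<bar> \<le> (R + 1)\<^sup>2 / sqrt lam * (1 / sqrt \<delta>)"
        using l by (intro mult_left_mono) auto
      also have "\<dots> = (R + 1)\<^sup>2 / sqrt \<epsilon>" using \<open>sqrt lam * sqrt \<delta> = sqrt \<epsilon>\<close> by simp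
      finally have ex: "exp ((R + 1)\<^sup>2 / sqrt lam * \<bar>x / sqrt (D x)\<bar>) \<le> CE" by (simp add: CE_def)
      have Ex0: "energy \<alpha> \<beta> lam y x \<ge> 0" unfolding E w_def using Dp l by simp
      have "energy \<alpha> \<beta> lam y x \<le> S * exp ((R + 1)\<^sup>2 / sqrt lam * \<bar>x / sqrt (D x)\<bar>)"
        using energy_comparable[OF ode, of x 0] x1 l by (simp add: S_def R_def D_def)
      also have "\<dots> \<le> S * CE" using ex S0 by (rule mult_left_mono)
      finally show "energy \<alpha> \<beta> lam y x \<le> CE * S" by (simp add: mult.commute)
      have "S \<le> energy \<alpha> \<beta> lam y x * exp ((R + 1)\<^sup>2 / sqrt lam * \<bar>x / sqrt (D x)\<bar>)"
        using energy_comparable[OF ode, of 0 x] x1 l by (simp add: S_def R_def D_def)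
      also have "\<dots> \<le> energy \<alpha> \<beta> lam y x * CE" using ex Ex0 by (rule mult_left_mono)
      finally show "S \<le> CE * energy \<alpha> \<beta> lam y x" by (simp add: mult.commute)
    qed
    have b12: "lam * (?y x)\<^sup>2 * (1 - x) powr a \<le> G * CE * S"
         "(z x)\<^sup>2 / D x * (1 - x) powr a \<le> G * CE * S" if x: "x \<in> {0..1 - \<delta>}" for x
    proof -
      have Dp: "D x > 0" using bulk(1)[OF x] x de by auto
      have t: "(z x)\<^sup>2 / D x \<ge> 0" "lam * (?y x)\<^sup>2 \<ge> 0" "w x \<ge> 0" using Dp l by (auto simp: w_def)
      have *: "v * (1 - x) powr a \<le> G * CE * S" if v: "0 \<le> v" "v \<le> (z x)\<^sup>2 / D x + lam * (?y x)\<^sup>2" for v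
      proof -
        have "v * (1 - x) powr a \<le> v * (G * w x)" using bulk(4)[OF x] v by (intro mult_left_mono) auto
        also have "\<dots> \<le> G * energy \<alpha> \<beta> lam y x"
        proof -
          have "w x * v \<le> energy \<alpha> \<beta> lam y x" unfolding E using v t by (intro mult_left_mono) auto
          then have "G * (w x * v) \<le> G * energy \<alpha> \<beta> lam y x" using G by (intro mult_left_mono) auto
          then show ?thesis by (simp add: mult_ac)
        qed
        also have "\<dots> \<le> G * (CE * S)" using bulk(5)[OF x] G by (intro mult_left_mono) auto
        finally show ?thesis by (simp add: mult.assoc)
      qed
      show "lam * (?y x)\<^sup>2 * (1 - x) powr a \<le> G * CE * S" using * t by simp
      show "(z x)\<^sup>2 / D x * (1 - x) powr a \<le> G * CE * S" using *[of "(z x)\<^sup>2 / D x"] t by simp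
    qed
    have b1: "lam * (?y x)\<^sup>2 \<le> G * CE * S * (1 - x) powr - a" if x: "x \<in> {0..1 - \<delta>}" for x
      using b12(1)[OF x] x de by (auto simp: powr_minus field_simps)
    have b2: "(?y' x)\<^sup>2 \<le> 2 * G * CE * (1 + R\<^sup>2 / \<epsilon>) * S * (1 - x) powr (- a - 1)"
      if x: "x \<in> {0..1 - \<delta>}" for x
    proof -
      define t where "t = 1 - x"
      have t: "t > 0" "t \<ge> \<delta>" "D x \<ge> t" using x de bulk(1)[OF x] by (auto simp: t_def)
      have "D x * ?y' x = z x + energy_slope \<alpha> \<beta> x * ?y x" by (simp add: z_def)
      then have "(D x * ?y' x)\<^sup>2 \<le> 2 * (z x)\<^sup>2 + 2 * ((energy_slope \<alpha> \<beta> x)\<^sup>2 * (?y x)\<^sup>2)"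
        using sum_square_le[of "z x" "energy_slope \<alpha> \<beta> x * ?y x"] by (simp add: power_mult_distrib)
      also have "\<dots> \<le> 2 * (z x)\<^sup>2 + 2 * (R\<^sup>2 * (?y x)\<^sup>2)"
        using rb[of x] x de by (intro add_left_mono mult_left_mono mult_right_mono) auto
      finally have "D x * D x * (?y' x)\<^sup>2 \<le> 2 * (z x)\<^sup>2 + 2 * (R\<^sup>2 * (?y x)\<^sup>2)"
        by (simp add: power_mult_distrib power2_eq_square mult_ac)
      then have "D x * (?y' x)\<^sup>2 \<le> 2 * ((z x)\<^sup>2 / D x) + 2 * (R\<^sup>2 * (?y x)\<^sup>2) / D x"
        using t by (simp add: field_simps)
      \<comment> \<open>Here the distance to the end pays off: dividing the slope term by
        \<open>D x \<ge> \<epsilon> / lam\<close> costs a factor lam, and lam y^2 is again part of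
        the energy.\<close>
      also have "\<dots> \<le> 2 * ((z x)\<^sup>2 / D x) + 2 * (R\<^sup>2 * (?y x)\<^sup>2) / (\<epsilon> / lam)"
        using t de mult_pos_pos[of "D x" \<delta>] unfolding \<delta>_def[symmetric]
        by (intro add_left_mono divide_left_mono) auto
      finally have "D x * (?y' x)\<^sup>2 \<le> 2 * ((z x)\<^sup>2 / D x) + 2 * R\<^sup>2 / \<epsilon> * (lam * (?y x)\<^sup>2)"
        by (simp add: mult_ac)
      moreover have "t * (?y' x)\<^sup>2 \<le> D x * (?y' x)\<^sup>2" using t by (intro mult_right_mono) auto
      ultimately have "t * (?y' x)\<^sup>2 * t powr a \<le> (2 * ((z x)\<^sup>2 / D x) + 2 * R\<^sup>2 / \<epsilon> * (lam * (?y x)\<^sup>2)) * t powr a"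
        by (intro mult_right_mono) auto
      also have "\<dots> = 2 * ((z x)\<^sup>2 / D x * t powr a) + 2 * R\<^sup>2 / \<epsilon> * (lam * (?y x)\<^sup>2 * t powr a)"
        by (simp add: algebra_simps)
      also have "\<dots> \<le> 2 * (G * CE * S) + 2 * R\<^sup>2 / \<epsilon> * (G * CE * S)"
        using b12[OF x] eps by (intro add_mono mult_left_mono) (auto simp: t_def)
      also have "\<dots> = 2 * G * CE * (1 + R\<^sup>2 / \<epsilon>) * S" by (simp add: algebra_simps)
      finally have *: "t * (?y' x)\<^sup>2 * t powr a \<le> 2 * G * CE * (1 + R\<^sup>2 / \<epsilon>) * S" .
      have "(?y' x)\<^sup>2 = t * (?y' x)\<^sup>2 * t powr a * t powr (- a - 1)"
        using t by (simp add: powr_diff powr_minus field_simps)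
      also have "\<dots> \<le> 2 * G * CE * (1 + R\<^sup>2 / \<epsilon>) * S * t powr (- a - 1)"
        using * by (intro mult_right_mono) auto
      finally show ?thesis by (simp add: t_def)
    qed
    have b3: "S * (1 - x) powr (- a - 1) \<le> 2 * G * CE * (?y' x)\<^sup>2"
      if x: "x \<in> {0..1 - \<delta>}" and 0: "?y x = 0" for x
    proof -
      define t where "t = 1 - x"
      have t: "t > 0" "t \<ge> \<delta>" "D x \<ge> t" using x de bulk(1)[OF x] by (auto simp: t_def)
      have "S \<le> CE * energy \<alpha> \<beta> lam y x" by (rule bulk(6)[OF x])
      also have "energy \<alpha> \<beta> lam y x = w x * (D x * (?y' x)\<^sup>2)"
        unfolding E z_def using 0 t by (simp add: power2_eq_square)
      also have "CE * (w x * (D x * (?y' x)\<^sup>2)) \<le> CE * (G * t powr a * (2 * t * (?y' x)\<^sup>2))"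
        using bulk(2,3)[OF x] t CE G by (intro mult_left_mono mult_mono mult_right_mono) (auto simp: t_def)
      finally have "S * t powr (- a - 1) \<le> CE * (G * t powr a * (2 * t * (?y' x)\<^sup>2)) * t powr (- a - 1)"
        by (rule mult_right_mono) auto
      also have "\<dots> = 2 * G * CE * (?y' x)\<^sup>2" using t by (simp add: powr_diff powr_minus field_simps)
      finally show ?thesis by (simp add: t_def)
    qed
    have x1: "1 - \<delta> \<in> {0..1 - \<delta>}" "1 - \<delta> \<in> {1 - \<delta>..1}" using de by auto
    have ed: "(?y x)\<^sup>2 \<le> 16/9 * Y" "4/9 * Y \<le> (?y x)\<^sup>2" "(?y' x)\<^sup>2 \<le> c\<^sup>2 * lam\<^sup>2 * Y"
      if x: "x \<in> {1 - \<delta>..1}" for x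
    proof -
      have e1: "\<bar>?y x - ?y 1\<bar> \<le> \<bar>?y 1\<bar> / 3" and e2: "\<bar>?y' x\<bar> \<le> 4 / 3 * lam / (\<alpha> + 1) * \<bar>?y 1\<bar>"
        using edge[OF _ _ x] l de by auto
      have "\<bar>?y x\<bar> \<le> 4/3 * \<bar>?y 1\<bar>" "2/3 * \<bar>?y 1\<bar> \<le> \<bar>?y x\<bar>" using e1 by linarith+
      from power_mono[OF this(1), of 2] power_mono[OF this(2), of 2]
      show "(?y x)\<^sup>2 \<le> 16/9 * Y" "4/9 * Y \<le> (?y x)\<^sup>2"
        by (simp_all add: Y_def power_mult_distrib power_divide)
      from power_mono[OF e2, of 2] show "(?y' x)\<^sup>2 \<le> c\<^sup>2 * lam\<^sup>2 * Y"
        by (simp add: Y_def power_mult_distrib power_divide c_def)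
    qed
    \<comment> \<open>The bound at the matching point \<open>1 - \<delta>\<close> passes to y(1),
      because |y| is still at least 2/3 of its end value there.\<close>
    have Y: "lam * Y \<le> 9/4 * (G * CE * S * \<delta> powr - a)"
    proof -
      have "lam * (4/9 * Y) \<le> lam * (?y (1 - \<delta>))\<^sup>2" using ed(2)[OF x1(2)] l by (intro mult_left_mono) auto
      also have "\<dots> \<le> G * CE * S * \<delta> powr - a" using b1[OF x1(1)] by simp
      finally show ?thesis by simp
    qed
    have GCS: "G * CE * S * \<delta> powr p \<ge> 0" for p using G CE S0 by simp
    have e1: "lam * (?y x)\<^sup>2 \<le> 4 * G * CE * S * \<delta> powr - a" if x: "x \<in> {1 - \<delta>..1}" for x
    proof -
      have "lam * (?y x)\<^sup>2 \<le> lam * (16/9 * Y)" using ed(1)[OF x] l by (intro mult_left_mono) auto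
      then show ?thesis using Y by simp
    qed
    have e2: "(?y' x)\<^sup>2 \<le> c\<^sup>2 * (4 * G * CE) * S * \<delta> powr (- a - 1)" if x: "x \<in> {1 - \<delta>..1}" for x
    proof -
      have "lam \<le> 1 / \<delta>" using de eps by (subst pos_le_divide_eq) auto
      have "(?y' x)\<^sup>2 \<le> c\<^sup>2 * (lam * (lam * Y))" using ed(3)[OF x] by (simp add: power2_eq_square mult_ac)
      also have "\<dots> \<le> c\<^sup>2 * (1 / \<delta> * (4 * (G * CE * S * \<delta> powr - a)))"
        using Y GCS[of "- a"] \<open>lam \<le> 1 / \<delta>\<close> l de
        by (intro mult_left_mono[of _ _ "c\<^sup>2"] mult_mono[of lam "1 / \<delta>"]) (auto simp: Y_def)
      also have "\<dots> = c\<^sup>2 * (4 * G * CE) * S * \<delta> powr (- a - 1)"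
        using de by (simp add: powr_diff)
      finally show ?thesis .
    qed
    \<comment> \<open>The converse: at \<open>1 - \<delta>\<close> the layer bounds both terms of
      the energy by multiples of lam y(1)^2, and that energy bounds \<open>S\<close>.\<close>
    have b4: "S * lam powr (a - 1) \<le> P4 * Y"
    proof -
      let ?x = "1 - \<delta>"
      have Dx: "D ?x \<ge> \<delta>" "D ?x \<le> 2 * \<delta>" using bulk(1,2)[OF x1(1)] by auto
      have "(z ?x)\<^sup>2 \<le> 2 * (D ?x * ?y' ?x)\<^sup>2 + 2 * (- energy_slope \<alpha> \<beta> ?x * ?y ?x)\<^sup>2"
        unfolding z_def using sum_square_le[of "D ?x * ?y' ?x" "- energy_slope \<alpha> \<beta> ?x * ?y ?x"] by simp
      also have "\<dots> \<le> 2 * ((D ?x)\<^sup>2 * (?y' ?x)\<^sup>2) + 2 * (R\<^sup>2 * (?y ?x)\<^sup>2)"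
        using rb[of ?x] de by (simp add: power_mult_distrib mult_right_mono)
      finally have "(z ?x)\<^sup>2 / D ?x \<le> (2 * ((D ?x)\<^sup>2 * (?y' ?x)\<^sup>2) + 2 * (R\<^sup>2 * (?y ?x)\<^sup>2)) / D ?x"
        using Dx de by (intro divide_right_mono) auto
      also have "\<dots> = 2 * D ?x * (?y' ?x)\<^sup>2 + 2 * (R\<^sup>2 * (?y ?x)\<^sup>2) / D ?x"
        using Dx de by (simp add: add_divide_distrib power2_eq_square)
      also have "\<dots> \<le> 2 * (2 * \<delta>) * (c\<^sup>2 * lam\<^sup>2 * Y) + 2 * (R\<^sup>2 * (16/9 * Y)) / \<delta>"
        using Dx de ed[OF x1(2)] by (intro add_mono mult_mono frac_le mult_left_mono) (auto simp: Y_def)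
      also have "2 * (2 * \<delta>) * (c\<^sup>2 * lam\<^sup>2 * Y) = 4 * c\<^sup>2 * (lam * \<delta>) * (lam * Y)"
        by (simp add: power2_eq_square)
      also have "\<dots> \<le> 4 * c\<^sup>2 * 1 * (lam * Y)"
        unfolding de(3) using eps l by (intro mult_mono mult_left_mono mult_right_mono) (auto simp: Y_def)
      also have "2 * (R\<^sup>2 * (16/9 * Y)) / \<delta> = 32/9 * R\<^sup>2 / \<epsilon> * (lam * Y)"
        using l eps by (simp add: \<delta>_def)
      also have "\<dots> \<le> 4 * R\<^sup>2 / \<epsilon> * (lam * Y)"
        using l eps by (intro mult_right_mono divide_right_mono) (auto simp: Y_def)
      finally have "(z ?x)\<^sup>2 / D ?x \<le> (4 * c\<^sup>2 + 4 * R\<^sup>2 / \<epsilon>) * (lam * Y)" by (simp add: algebra_simps)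
      moreover have "lam * (?y ?x)\<^sup>2 \<le> 2 * (lam * Y)"
      proof -
        have "lam * (?y ?x)\<^sup>2 \<le> lam * (16/9 * Y)" using ed(1)[OF x1(2)] l by (intro mult_left_mono) auto
        also have "\<dots> \<le> 2 * (lam * Y)" using l by (simp add: Y_def)
        finally show ?thesis .
      qed
      ultimately have b: "(z ?x)\<^sup>2 / D ?x + lam * (?y ?x)\<^sup>2 \<le> C4 * (lam * Y)"
        by (simp add: C4_def algebra_simps)
      have "S \<le> CE * energy \<alpha> \<beta> lam y ?x" by (rule bulk(6)[OF x1(1)])
      also have "\<dots> \<le> CE * (G * \<delta> powr a * (C4 * (lam * Y)))"
        unfolding E using bulk(3)[OF x1(1)] b CE G Dx de l
        by (intro mult_left_mono mult_mono) (auto simp: w_def)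
      finally have "S * lam powr (a - 1) \<le> CE * (G * \<delta> powr a * (C4 * (lam * Y))) * lam powr (a - 1)"
        by (rule mult_right_mono) auto
      also have "\<dots> = CE * G * C4 * (\<delta> powr a * lam powr a) * Y" using l by (simp add: powr_diff)
      also have "\<delta> powr a * lam powr a = \<epsilon> powr a" using de l by (simp add: powr_mult[symmetric] mult.commute)
      finally show ?thesis by (simp add: P4_def)
    qed
    have up: "q * S * u powr p \<le> q * k powr \<bar>p\<bar> * S * A x powr p"
      if "q \<ge> 0" "(u = 1 - x \<and> x \<in> {0..1 - \<delta>}) \<or> (u = \<delta> \<and> x \<in> {1 - \<delta>..1})" for q u x p
    proof -
      have "q * S * u powr p \<le> q * S * (k powr \<bar>p\<bar> * A x powr p)"
        using pw[OF that(2)] that(1) S0 by (intro mult_left_mono) auto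
      then show ?thesis by (simp add: mult_ac)
    qed
    have upC: "q * S * u powr p \<le> C * S * u powr p" if "q \<le> C" for q u p
      using that S0 by (intro mult_right_mono) auto
    have A1: "lam * (?y x)\<^sup>2 \<le> C * S * A x powr - a" if x: "x \<in> {0..1}" for x
    proof (cases "x \<le> 1 - \<delta>")
      case True
      have "lam * (?y x)\<^sup>2 \<le> 4 * G * CE * S * (1 - x) powr - a"
        using b1[of x] x True G CE S0 by (auto intro: order_trans mult_right_mono)
      also have "\<dots> \<le> 4 * G * CE * k powr \<bar>- a\<bar> * S * A x powr - a"
        using x True G CE by (intro up) auto
      also have "\<dots> \<le> C * S * A x powr - a" using C(2) unfolding P1_def by (rule upC)
      finally show ?thesis .
    next
      case False
      have "lam * (?y x)\<^sup>2 \<le> 4 * G * CE * S * \<delta> powr - a" using e1[of x] x False by auto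
      also have "\<dots> \<le> 4 * G * CE * k powr \<bar>- a\<bar> * S * A x powr - a"
        using x False G CE by (intro up) auto
      also have "\<dots> \<le> C * S * A x powr - a" using C(2) unfolding P1_def by (rule upC)
      finally show ?thesis .
    qed
    have A2: "(?y' x)\<^sup>2 \<le> C * S * A x powr (- a - 1)" if x: "x \<in> {0..1}" for x
    proof -
      define Q where "Q = 2 * G * CE * (1 + R\<^sup>2 / \<epsilon>) + c\<^sup>2 * (4 * G * CE)"
      have Q: "2 * G * CE * (1 + R\<^sup>2 / \<epsilon>) \<le> Q" "c\<^sup>2 * (4 * G * CE) \<le> Q" "Q \<ge> 0" using G CE eps by (auto simp: Q_def)
      have QS: "q * S * u powr p \<le> Q * S * u powr p" if "q \<le> Q" for q u p
        using that S0 by (intro mult_right_mono) auto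
      have "\<exists>u. ((u = 1 - x \<and> x \<in> {0..1 - \<delta>}) \<or> (u = \<delta> \<and> x \<in> {1 - \<delta>..1})) \<and>
              (?y' x)\<^sup>2 \<le> Q * S * u powr (- a - 1)"
      proof (cases "x \<le> 1 - \<delta>")
        case True
        then show ?thesis using b2[of x] x QS[OF Q(1)] by (intro exI[of _ "1 - x"]) (auto intro: order_trans)
      next
        case False
        then show ?thesis using e2[of x] x QS[OF Q(2)] by (intro exI[of _ \<delta>]) (auto intro: order_trans)
      qed
      then obtain u where u: "(u = 1 - x \<and> x \<in> {0..1 - \<delta>}) \<or> (u = \<delta> \<and> x \<in> {1 - \<delta>..1})"
        and "(?y' x)\<^sup>2 \<le> Q * S * u powr (- a - 1)" by blast
      note this(2)
      also have "Q * S * u powr (- a - 1) \<le> Q * k powr \<bar>- a - 1\<bar> * S * A x powr (- a - 1)"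
        by (rule up[OF Q(3) u])
      also have "\<dots> \<le> C * S * A x powr (- a - 1)" using C(3) unfolding P2_def Q_def by (rule upC)
      finally show ?thesis .
    qed
    have A3: "S * A x powr (- a - 1) \<le> C * (?y' x)\<^sup>2 \<and> A x \<le> C * (1 - x)"
      if x: "x \<in> {0..1}" and 0: "?y x = 0" and S: "S > 0" for x
    proof -
      \<comment> \<open>A root in the layer would force y(1) = 0, since |y| is at least 2/3 of
        |y(1)| there; \<open>b4\<close> excludes this for \<open>S > 0\<close>.\<close>
      have "x \<le> 1 - \<delta>"
      proof (rule ccontr)
        assume "\<not> x \<le> 1 - \<delta>"
        then have "Y \<le> 0" using ed(2)[of x] 0 x by auto
        then have "Y = 0" by (simp add: Y_def)
        then have "S * lam powr (a - 1) \<le> 0" using b4 by simp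
        moreover have "S * lam powr (a - 1) > 0" using S l by simp
        ultimately show False by simp
      qed
      then have xb: "x \<in> {0..1 - \<delta>}" using x by auto
      have kd: "A x \<le> k * (1 - x)"
      proof -
        have "1 / lam = (k - 1) * \<delta>" using eps l by (simp add: k_def \<delta>_def)
        also have "\<dots> \<le> (k - 1) * (1 - x)" using xb k by (intro mult_left_mono) auto
        finally show ?thesis by (simp add: A_def algebra_simps)
      qed
      have Ap: "A x > 0" using x l by (auto simp: A_def add_nonneg_pos)
      have "A x powr (- a - 1) \<le> k powr \<bar>- a - 1\<bar> * (1 - x) powr (- a - 1)"
      proof (rule powr_le_powr_of_comparable)
        have "1 - x \<le> A x" using l by (simp add: A_def)
        also have "A x \<le> k * A x" using Ap k mult_right_mono[of 1 k "A x"] by simp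
        finally show "1 - x \<le> k * A x" .
      qed (use Ap k kd xb de in auto)
      then have "S * A x powr (- a - 1) \<le> S * (k powr \<bar>- a - 1\<bar> * (1 - x) powr (- a - 1))"
        using S by (intro mult_left_mono) auto
      also have "\<dots> = k powr \<bar>- a - 1\<bar> * (S * (1 - x) powr (- a - 1))" by simp
      also have "\<dots> \<le> k powr \<bar>- a - 1\<bar> * (2 * G * CE * (?y' x)\<^sup>2)"
        using b3[OF xb 0] by (intro mult_left_mono) auto
      also have "\<dots> = P3 * (?y' x)\<^sup>2" by (simp add: P3_def)
      also have "\<dots> \<le> C * (?y' x)\<^sup>2" using C(4) by (rule mult_right_mono) auto
      finally have "S * A x powr (- a - 1) \<le> C * (?y' x)\<^sup>2" .
      moreover have "k * (1 - x) \<le> C * (1 - x)" using C x by (intro mult_right_mono) auto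
      ultimately show ?thesis using kd by auto
    qed
    have A4: "S * lam powr (a - 1) \<le> C * (?y 1)\<^sup>2"
      using b4 C(5) mult_right_mono[of P4 C Y] by (auto simp: Y_def)
    show ?thesis
      unfolding edge_bounds_def S_def[symmetric] A_def[symmetric] using A1 A2 A3 A4 by blast
  qed
  show ?thesis
    using main C(1) unfolding a_def by (intro exI[of _ C] exI[of _ lam0]) (auto simp: lam0_def)
qed

section \<open>The family of Jacobi polynomials\<close>

definition jacobi_eigenvalue :: "real \<Rightarrow> real \<Rightarrow> nat \<Rightarrow> real" where
  "jacobi_eigenvalue \<alpha> \<beta> m = real m * (real m + \<alpha> + \<beta> + 1)"

lemma gbinomial_shift_pos: "\<alpha> > -1 \<Longrightarrow> (real m + \<alpha>) gchoose m > 0"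
  unfolding gbinomial_prod_rev by (intro divide_pos_pos prod_pos) auto

text \<open>A power series in 1 - x: \<open>f\<close> is the ratio of consecutive coefficients of
  the hypergeometric series 2F1(-m, m + \<alpha> + \<beta> + 1; \<alpha> + 1; (1 - x)/2). It
  terminates because \<open>f m = 0\<close>, and its constant coefficient is the prescribed value at
  1.\<close>

lemma jacobi_ode_solution_exists:
  assumes "\<alpha> > -1" "\<beta> > -1"
  shows "\<exists>y. jacobi_ode \<alpha> \<beta> (jacobi_eigenvalue \<alpha> \<beta> m) y \<and> degree y = m \<and> poly y 1 = (real m + \<alpha>) gchoose m"
proof -
  define f where "f i = (real i - real m) * (real i + real m + \<alpha> + \<beta> + 1) / ((real i + 1) * (2 * real i + 2 * \<alpha> + 2))" for i
  define c where "c j = ((real m + \<alpha>) gchoose m) * prod f {..<j}" for j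
  have c0: "c j = 0" if "j > m" for j
  proof -
    have "f m = 0" by (simp add: f_def)
    then have "prod f {..<j} = 0" using that by (intro prod_zero) auto
    then show ?thesis by (simp add: c_def)
  qed
  define q where "q = (\<Sum>j\<le>m. monom (c j) j)"
  have q: "coeff q j = c j" for j
    using c0[of j] by (auto simp: q_def coeff_sum)
  have rec: "c (Suc j) * ((real j + 1) * (2 * real j + 2 * \<alpha> + 2)) = c j * ((real j - real m) * (real j + real m + \<alpha> + \<beta> + 1))" for j
  proof -
    have "(real j + 1) * (2 * real j + 2 * \<alpha> + 2) \<noteq> 0" using assms by (simp add: add_eq_0_iff)
    then show ?thesis by (simp add: c_def f_def)
  qed
  \<comment> \<open>The Jacobi equation in the variable t = 1 - x, where 1 - x^2 = 2 t -
    t^2.\<close>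
  have "[:0, 2, -1:] * pderiv (pderiv q) + [:2 * (\<alpha> + 1), - (\<alpha> + \<beta> + 2):] * pderiv q
      + smult (jacobi_eigenvalue \<alpha> \<beta> m) q = 0" (is "?p = 0")
  proof (rule poly_eqI)
    fix j
    have "coeff ?p j = c (Suc j) * ((real j + 1) * (2 * real j + 2 * \<alpha> + 2))
        - c j * ((real j - real m) * (real j + real m + \<alpha> + \<beta> + 1))"
    proof (cases j)
      case 0
      show ?thesis unfolding 0 coeff_add
        by (simp add: coeff_pderiv q jacobi_eigenvalue_def)
    next
      case (Suc i)
      show ?thesis
      proof (cases i)
        case 0
        then show ?thesis unfolding Suc coeff_add
          by (simp add: coeff_pderiv q jacobi_eigenvalue_def del: of_nat_Suc) (simp add: ring_distribs)
      next
        case (Suc i')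
        show ?thesis unfolding \<open>j = Suc i\<close> Suc coeff_add
          by (simp add: coeff_pderiv q jacobi_eigenvalue_def del: of_nat_Suc, simp only: of_nat_Suc, algebra)
      qed
    qed
    then show "coeff ?p j = coeff 0 j" using rec[of j] by simp
  qed
  then have ode: "(2 * t - t\<^sup>2) * poly (pderiv (pderiv q)) t + (2 * (\<alpha> + 1) - (\<alpha> + \<beta> + 2) * t) * poly (pderiv q) t
      + jacobi_eigenvalue \<alpha> \<beta> m * poly q t = 0" for t
  proof -
    have "poly ?p t = 0" using \<open>?p = 0\<close> by (simp only: poly_0)
    then show ?thesis by (simp add: power2_eq_square) algebra
  qed
  define y where "y = q \<circ>\<^sub>p [:1, -1:]"
  have "jacobi_ode \<alpha> \<beta> (jacobi_eigenvalue \<alpha> \<beta> m) y"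
    unfolding jacobi_ode_def
  proof
    fix x :: real
    show "(1 - x\<^sup>2) * poly (pderiv (pderiv y)) x + (\<beta> - \<alpha> - (\<alpha> + \<beta> + 2) * x) * poly (pderiv y) x
        + jacobi_eigenvalue \<alpha> \<beta> m * poly y x = 0"
    proof -
      have "pderiv y = - (pderiv q \<circ>\<^sub>p [:1, -1:])" "pderiv (pderiv y) = pderiv (pderiv q) \<circ>\<^sub>p [:1, -1:]"
        by (simp_all add: y_def pderiv_pcompose pderiv_pCons pderiv_minus)
      then have "poly (pderiv y) x = - poly (pderiv q) (1 - x)" "poly (pderiv (pderiv y)) x = poly (pderiv (pderiv q)) (1 - x)"
        "poly y x = poly q (1 - x)"
        by (simp_all add: y_def poly_pcompose)
      then show ?thesis using ode[of "1 - x"] by algebra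
    qed
  qed
  moreover have "degree q = m"
  proof (rule antisym)
    show "degree q \<le> m" using q c0 by (intro degree_le) auto
    have "(real m + \<alpha>) gchoose m \<noteq> 0"
      using gbinomial_shift_pos[OF assms(1), of m] by simp
    \<comment> \<open>The second factor of the numerator is positive: \<open>i < m\<close> gives i +
      m \<ge> 1, and \<alpha> + \<beta> > -2.\<close>
    moreover have "f i \<noteq> 0" if "i < m" for i
    proof -
      have "real i + real m \<ge> 1" using that by linarith
      then show ?thesis using that assms by (auto simp: f_def add_eq_0_iff)
    qed
    ultimately have "c m \<noteq> 0" by (auto simp: c_def)
    then show "m \<le> degree q" by (intro le_degree) (simp add: q)
  qed
  then have "degree y = m" by (simp add: y_def degree_pcompose)
  moreover have "poly y 1 = (real m + \<alpha>) gchoose m"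
    using q[of 0] by (simp add: y_def poly_pcompose poly_0_coeff_0 c_def)
  ultimately show ?thesis by blast
qed

section \<open>Integration against the Jacobi weight and orthogonality\<close>

lemma jacobi_weight_integrable:
  assumes "\<alpha> > -1" "\<beta> > -1"
  shows "set_integrable lborel {-1..1} (\<lambda>t. poly p t * jacobi_weight \<alpha> \<beta> t)"
proof -
  define F where "F t = t powr \<beta> * (1 - t) powr \<alpha>" for t :: real
  \<comment> \<open>The substitution x = 2 s - 1 turns the weight into a constant multiple of the
    Beta integrand, which is integrable because both exponents exceed -1.\<close>
  have "((\<lambda>t. t powr (\<beta> + 1 - 1) * (1 - t) powr (\<alpha> + 1 - 1)) has_integral Beta (\<beta> + 1) (\<alpha> + 1)) {0..1}"
    using assms by (intro has_integral_Beta_real) auto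
  then have F: "(F has_integral Beta (\<beta> + 1) (\<alpha> + 1)) (cbox 0 1)" by (simp add: F_def[abs_def])
  have "(\<lambda>x. (1 / (1/2)) *\<^sub>R x + - ((1 / (1/2)) *\<^sub>R (1/2))) ` cbox 0 1 = {-1..1::real}"
    unfolding cbox_interval real_scaleR_def by (subst image_affinity_atLeastAtMost) auto
  moreover have "(\<lambda>x. F ((1/2) *\<^sub>R x + 1/2)) integrable_on
      ((\<lambda>x. (1 / (1/2)) *\<^sub>R x + - ((1 / (1/2)) *\<^sub>R (1/2))) ` cbox 0 1)"
    by (intro integrable_affinity has_integral_integrable[OF F]) simp
  ultimately have "(\<lambda>x. F (1/2 * x + 1/2)) integrable_on {-1..1}" by (simp only: real_scaleR_def)
  moreover have "F (1/2 * x + 1/2) = jacobi_weight \<alpha> \<beta> x * ((1/2) powr \<alpha> * (1/2) powr \<beta>)"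
    if "x \<in> {-1..1}" for x
  proof -
    have "1/2 * x + 1/2 = (1 + x) * (1/2)" "1 - (1/2 * x + 1/2) = (1 - x) * (1/2)" by simp_all
    then show ?thesis using that unfolding jacobi_weight_def F_def by (simp only: powr_mult mult_ac)
  qed
  ultimately have "(\<lambda>x. jacobi_weight \<alpha> \<beta> x * of_real ((1/2) powr \<alpha> * (1/2) powr \<beta>)) integrable_on {-1..1}"
    by (subst integrable_cong[symmetric, of _ "\<lambda>x. F (1/2 * x + 1/2)"]) (simp_all only: id_apply of_real_eq_id)
  then have "jacobi_weight \<alpha> \<beta> integrable_on {-1..1}"
    by (subst (asm) integrable_on_cmult_right_iff) auto
  then have "jacobi_weight \<alpha> \<beta> absolutely_integrable_on {-1..1}"
    by (intro nonnegative_absolutely_integrable_1) (auto simp: jacobi_weight_def)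
  moreover have m: "jacobi_weight \<alpha> \<beta> \<in> borel_measurable borel"
    unfolding jacobi_weight_def by measurable
  ultimately have w: "integrable lborel (\<lambda>t. indicator {-1..1} t *\<^sub>R jacobi_weight \<alpha> \<beta> t)"
    unfolding set_integrable_def by (subst (asm) integrable_completion) auto
  have "bounded (poly p ` {-1..1})"
    by (intro compact_imp_bounded compact_continuous_image continuous_intros) auto
  then obtain B where B: "\<And>t. t \<in> {-1..1} \<Longrightarrow> \<bar>poly p t\<bar> \<le> B"
    unfolding bounded_iff by (metis image_eqI real_norm_def)
  have pm: "poly p \<in> borel_measurable borel"
    by (intro borel_measurable_continuous_onI continuous_intros)
  show ?thesis
    unfolding set_integrable_def
  proof (rule Bochner_Integration.integrable_bound)
    show "integrable lborel (\<lambda>t. B * (indicator {-1..1} t *\<^sub>R jacobi_weight \<alpha> \<beta> t))"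
      using w by (rule integrable_mult_right)
    show "(\<lambda>t. indicator {-1..1} t *\<^sub>R (poly p t * jacobi_weight \<alpha> \<beta> t)) \<in> borel_measurable lborel"
      using m pm by measurable
    show "AE t in lborel. norm (indicator {-1..1} t *\<^sub>R (poly p t * jacobi_weight \<alpha> \<beta> t))
        \<le> norm (B * (indicator {-1..1} t *\<^sub>R jacobi_weight \<alpha> \<beta> t))"
    proof (intro AE_I2)
      fix t :: real
      have "\<bar>poly p t\<bar> * \<bar>jacobi_weight \<alpha> \<beta> t\<bar> \<le> \<bar>B\<bar> * \<bar>jacobi_weight \<alpha> \<beta> t\<bar>" if "t \<in> {-1..1}"
        using B[OF that] by (intro mult_right_mono) auto
      then show "norm (indicator {-1..1} t *\<^sub>R (poly p t * jacobi_weight \<alpha> \<beta> t))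
        \<le> norm (B * (indicator {-1..1} t *\<^sub>R jacobi_weight \<alpha> \<beta> t))"
        by (auto simp: indicator_def abs_mult)
    qed
  qed
qed

definition jacobi_integral :: "real \<Rightarrow> real \<Rightarrow> real poly \<Rightarrow> real" where
  "jacobi_integral \<alpha> \<beta> p = (LINT t:{-1..1}|lborel. poly p t * jacobi_weight \<alpha> \<beta> t)"

context
  fixes \<alpha> \<beta> :: real
  assumes exponents: "\<alpha> > -1" "\<beta> > -1"
begin

lemma jacobi_integral_add: "jacobi_integral \<alpha> \<beta> (p + q) = jacobi_integral \<alpha> \<beta> p + jacobi_integral \<alpha> \<beta> q"
  unfolding jacobi_integral_def
  by (subst set_integral_add(2)[symmetric]) (auto simp: jacobi_weight_integrable exponents algebra_simps)

lemma jacobi_integral_smult: "jacobi_integral \<alpha> \<beta> (smult c p) = c * jacobi_integral \<alpha> \<beta> p"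
  by (simp add: jacobi_integral_def mult.assoc)

text \<open>A nonnegative function with integral zero vanishes almost everywhere, but a nonzero
  polynomial times the weight has only finitely many zeros in the open interval.\<close>

lemma jacobi_integral_eq_0_imp:
  assumes "\<And>t. t \<in> {-1<..<1} \<Longrightarrow> poly p t \<ge> 0" and "jacobi_integral \<alpha> \<beta> p = 0"
  shows "p = 0"
proof (rule ccontr)
  assume "p \<noteq> 0"
  then have fin: "finite {t. poly p t = 0}" by (rule poly_roots_finite)
  let ?f = "\<lambda>t. indicator {-1..1} t *\<^sub>R (poly p t * jacobi_weight \<alpha> \<beta> t)"
  have ends: "AE t in lborel. t \<noteq> -1 \<and> t \<noteq> (1::real)"
    using AE_lborel_singleton[of "-1"] AE_lborel_singleton[of "1::real"] by eventually_elim auto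
  have nn: "AE t in lborel. 0 \<le> ?f t"
    using ends by eventually_elim (use assms(1) in \<open>auto simp: jacobi_weight_def indicator_def\<close>)
  have int: "integrable lborel ?f"
    using jacobi_weight_integrable[OF exponents] by (simp add: set_integrable_def)
  have "AE t in lborel. ?f t = 0"
    using assms(2) integral_nonneg_eq_0_iff_AE[OF int nn]
    unfolding jacobi_integral_def set_lebesgue_integral_def by blast
  moreover have "AE t in lborel. t \<notin> {t. poly p t = 0}"
    by (rule AE_not_in) (rule finite_imp_null_set_lborel[OF fin])
  ultimately have "AE t in lborel. t \<notin> {-1<..<(1::real)}"
    by eventually_elim (auto simp: indicator_def jacobi_weight_def split: if_splits)
  then have "{-1<..<(1::real)} \<in> null_sets lborel" by (simp add: AE_iff_null_sets)
  then show False by (simp add: null_sets_def)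
qed

text \<open>In self-adjoint form the equation is ((1 - x)^(\<alpha> + 1) (1 + x)^(\<beta> + 1) y')'
  = - lam w y with w the weight. So the weighted Wronskian \<open>V\<close> has derivative (l - k) p
  q w, and it vanishes at both ends because its exponents are positive.\<close>

lemma jacobi_ode_orthogonal:
  assumes p: "jacobi_ode \<alpha> \<beta> l p" and q: "jacobi_ode \<alpha> \<beta> k q" and "l \<noteq> k"
  shows "jacobi_integral \<alpha> \<beta> (p * q) = 0"
proof -
  let ?w = "jacobi_weight \<alpha> \<beta>"
  define V where "V x = (1 - x) powr (\<alpha> + 1) * (1 + x) powr (\<beta> + 1) *
      poly (p * pderiv q - pderiv p * q) x" for x
  have "((\<lambda>t. (l - k) * (poly (p * q) t * ?w t)) has_integral (V 1 - V (-1))) {-1..1}"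
  \<comment> \<open>At the end points \<open>V\<close> is continuous, but the integrand may be
    unbounded near them.\<close>
  proof (rule fundamental_theorem_of_calculus_interior)
    show "continuous_on {-1..1} V"
      unfolding V_def using exponents
      by (intro continuous_intros continuous_on_powr') auto
    fix x :: real assume x: "x \<in> {-1<..<1}"
    have pd: "((\<lambda>x. u x powr s) has_real_derivative u x powr (s - 1) * (s * d)) (at x)"
      if "(u has_real_derivative d) (at x)" "u x > 0" for u :: "real \<Rightarrow> real" and s d
      using DERIV_fun_powr[OF that, of s] by (simp add: mult_ac)
    have d1: "((\<lambda>x. (1 - x) powr (\<alpha> + 1)) has_real_derivative (1 - x) powr (\<alpha> + 1 - 1) * ((\<alpha> + 1) * (- 1))) (at x)"
      using x by (intro pd) (auto intro!: derivative_eq_intros)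
    have d2: "((\<lambda>x. (1 + x) powr (\<beta> + 1)) has_real_derivative (1 + x) powr (\<beta> + 1 - 1) * ((\<beta> + 1) * 1)) (at x)"
      using x by (intro pd) (auto intro!: derivative_eq_intros)
    define A B where "A = (1 - x) powr \<alpha>" and "B = (1 + x) powr \<beta>"
    have AB: "(1 - x) powr (\<alpha> + 1) = A * (1 - x)" "(1 + x) powr (\<beta> + 1) = B * (1 + x)"
      using x by (simp_all add: A_def B_def powr_add)
    define V' where "V' =
       (A * (- (\<alpha> + 1)) * (B * (1 + x)) + B * (\<beta> + 1) * (A * (1 - x))) * poly (p * pderiv q - pderiv p * q) x
       + poly (pderiv (p * pderiv q - pderiv p * q)) x * (A * (1 - x) * (B * (1 + x)))"
    have "(V has_real_derivative V') (at x)"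
      unfolding V_def V'_def
      using DERIV_mult[OF DERIV_mult[OF d1 d2] poly_DERIV[of "p * pderiv q - pderiv p * q" x]]
      by (simp add: AB A_def[symmetric] B_def[symmetric])
    moreover have "V' = (l - k) * (poly (p * q) x * ?w x)"
    proof -
      have w: "?w x = A * B" by (simp add: jacobi_weight_def A_def B_def)
      define p0 p1 p2 q0 q1 q2 where "p0 = poly p x" and "p1 = poly (pderiv p) x" and "p2 = poly (pderiv (pderiv p)) x"
        and "q0 = poly q x" and "q1 = poly (pderiv q) x" and "q2 = poly (pderiv (pderiv q)) x"
      have e: "(1 - x\<^sup>2) * p2 = - (\<beta> - \<alpha> - (\<alpha> + \<beta> + 2) * x) * p1 - l * p0"
        "(1 - x\<^sup>2) * q2 = - (\<beta> - \<alpha> - (\<alpha> + \<beta> + 2) * x) * q1 - k * q0"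
        using p[unfolded jacobi_ode_def, rule_format, of x] q[unfolded jacobi_ode_def, rule_format, of x]
        by (simp_all only: p0_def p1_def p2_def q0_def q1_def q2_def minus_mult_left[symmetric])
      have "(A * (- (\<alpha> + 1)) * (B * (1 + x)) + B * (\<beta> + 1) * (A * (1 - x))) * (p0 * q1 - p1 * q0)
         + (p0 * q2 - p2 * q0) * (A * (1 - x) * (B * (1 + x))) = (l - k) * (p0 * q0 * (A * B))"
        using e by algebra
      then show ?thesis
        by (simp add: V'_def w pderiv_diff pderiv_mult p0_def p1_def p2_def q0_def q1_def q2_def algebra_simps)
    qed
    ultimately show "(V has_vector_derivative (l - k) * (poly (p * q) x * ?w x)) (at x)"
      by (simp add: has_real_derivative_iff_has_vector_derivative)
  qed simp
  moreover have "V 1 = 0" "V (-1) = 0" by (simp_all add: V_def)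
  ultimately have "((\<lambda>t. (l - k) * (poly (p * q) t * ?w t)) has_integral 0) {-1..1}" by simp
  moreover have "((\<lambda>t. poly (p * q) t * ?w t) has_integral jacobi_integral \<alpha> \<beta> (p * q)) {-1..1}"
    unfolding jacobi_integral_def
    using set_borel_integral_eq_integral[OF jacobi_weight_integrable[OF exponents]]
    by (metis integrable_integral)
  then have "((\<lambda>t. (l - k) * (poly (p * q) t * ?w t)) has_integral (l - k) * jacobi_integral \<alpha> \<beta> (p * q)) {-1..1}"
    by (rule has_integral_mult_right)
  ultimately have "(l - k) * jacobi_integral \<alpha> \<beta> (p * q) = 0"
    using has_integral_unique by blast
  then show ?thesis using \<open>l \<noteq> k\<close> by simp
qed

lemma jacobi_eigenvalue_inj: "jacobi_eigenvalue \<alpha> \<beta> m = jacobi_eigenvalue \<alpha> \<beta> k \<longleftrightarrow> m = k"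
proof
  assume "jacobi_eigenvalue \<alpha> \<beta> m = jacobi_eigenvalue \<alpha> \<beta> k"
  then have "(real m - real k) * (real m + real k + \<alpha> + \<beta> + 1) = 0"
    by (simp add: jacobi_eigenvalue_def algebra_simps)
  moreover have "real m + real k + \<alpha> + \<beta> + 1 \<noteq> 0" if "m \<noteq> k"
  proof -
    have "real m + real k \<ge> 1" using that by linarith
    then show ?thesis using exponents by linarith
  qed
  ultimately show "m = k" by auto
qed simp

lemma jacobi_family_iff:
  "is_jacobi_family \<alpha> \<beta> P \<longleftrightarrow> (\<forall>m. degree (P m) = m) \<and>
     (\<forall>m k. m \<noteq> k \<longrightarrow> jacobi_integral \<alpha> \<beta> (P m * P k) = 0) \<and>
     (\<forall>m. poly (P m) 1 = (real m + \<alpha>) gchoose m)"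
  by (simp add: is_jacobi_family_def jacobi_integral_def)

text \<open>Subtracting a multiple of the member of the same degree lowers the degree of
  \<open>p\<close>. The alternative \<open>p = 0\<close> is carried along because the remainder may
  vanish, and the degree of the zero polynomial is not below \<open>m = 0\<close>.\<close>

lemma jacobi_family_orthogonal_lower_degree:
  assumes P: "is_jacobi_family \<alpha> \<beta> P" and "degree p < m \<or> p = 0"
  shows "jacobi_integral \<alpha> \<beta> (P m * p) = 0"
  using assms(2)
proof (induction "degree p" arbitrary: p rule: less_induct)
  case less
  show ?case
  proof (cases "p = 0")
    case True then show ?thesis by (simp add: jacobi_integral_def)
  next
    case False
    define d where "d = degree p"
    have Pd: "degree (P d) = d" "degree (P d) = degree p" using P by (auto simp: jacobi_family_iff d_def)
    have "lead_coeff (P d) \<noteq> 0"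
    proof
      assume "lead_coeff (P d) = 0"
      then have "P d = 0" by simp
      moreover have "poly (P d) 1 \<noteq> 0"
        using P gbinomial_shift_pos[OF exponents(1), of d] by (simp add: jacobi_family_iff)
      ultimately show False by simp
    qed
    define c where "c = lead_coeff p / lead_coeff (P d)"
    define r where "r = p - smult c (P d)"
    have c0: "c \<noteq> 0" using False \<open>lead_coeff (P d) \<noteq> 0\<close> by (simp add: c_def)
    have "coeff r d = 0" using Pd \<open>lead_coeff (P d) \<noteq> 0\<close> by (simp add: r_def c_def d_def)
    moreover have "degree r \<le> d" unfolding r_def
      using Pd(1) degree_smult_le[of c "P d"] by (intro degree_diff_le) (simp_all add: d_def)
    ultimately have r: "degree r < d \<or> r = 0"
      by (metis le_neq_implies_less leading_coeff_0_iff)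
    have "jacobi_integral \<alpha> \<beta> (P m * r) = 0"
      using r less by (cases "r = 0") (auto simp: d_def jacobi_integral_def[of _ _ 0])
    moreover have "jacobi_integral \<alpha> \<beta> (P m * P d) = 0"
      using P less.prems False by (auto simp: jacobi_family_iff d_def)
    moreover have "P m * p = P m * r + smult c (P m * P d)" by (simp add: r_def algebra_simps)
    ultimately show ?thesis by (simp add: jacobi_integral_add jacobi_integral_smult)
  qed
qed

text \<open>The combination \<open>r\<close> cancels the leading terms of \<open>P m\<close> and
  \<open>Q m\<close>, so both are orthogonal to \<open>r\<close>, hence \<open>r\<close> to itself.
  The two are therefore proportional, and their common nonzero value at 1 fixes the factor.\<close>

lemma jacobi_family_unique:
  assumes P: "is_jacobi_family \<alpha> \<beta> P" and Q: "is_jacobi_family \<alpha> \<beta> Q"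
  shows "P = Q"
proof
  fix m
  have g: "(real m + \<alpha>) gchoose m \<noteq> 0"
    using gbinomial_shift_pos[OF exponents(1), of m] by simp
  have P1: "degree (P m) = m" "poly (P m) 1 = (real m + \<alpha>) gchoose m"
    and Q1: "degree (Q m) = m" "poly (Q m) 1 = (real m + \<alpha>) gchoose m"
    using P Q by (auto simp: jacobi_family_iff)
  have l: "lead_coeff (P m) \<noteq> 0" "lead_coeff (Q m) \<noteq> 0"
    using P1(2) Q1(2) g by (metis leading_coeff_0_iff poly_0)+
  define r where "r = smult (lead_coeff (Q m)) (P m) + smult (- lead_coeff (P m)) (Q m)"
  have "coeff r m = 0" using P1 Q1 by (simp add: r_def)
  moreover have "degree r \<le> m" unfolding r_def using P1 Q1 by (intro degree_add_le) auto
  ultimately have r: "degree r < m \<or> r = 0" by (metis le_neq_implies_less leading_coeff_0_iff)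
  have "r * r = (smult (lead_coeff (Q m)) (P m) + smult (- lead_coeff (P m)) (Q m)) * r"
    by (simp only: r_def)
  then have "r * r = smult (lead_coeff (Q m)) (P m * r) + smult (- lead_coeff (P m)) (Q m * r)"
    by (simp only: distrib_right mult_smult_left)
  then have "jacobi_integral \<alpha> \<beta> (r * r) = 0"
    using jacobi_family_orthogonal_lower_degree[OF P r] jacobi_family_orthogonal_lower_degree[OF Q r]
    by (simp only: jacobi_integral_add jacobi_integral_smult)
  then have "r * r = 0" by (rule jacobi_integral_eq_0_imp[rotated]) simp
  then have e: "smult (lead_coeff (Q m)) (P m) = smult (lead_coeff (P m)) (Q m)" by (simp add: r_def)
  then have "lead_coeff (Q m) * poly (P m) 1 = lead_coeff (P m) * poly (Q m) 1" by (metis poly_smult)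
  then have "lead_coeff (Q m) = lead_coeff (P m)" using P1 Q1 g by simp
  then show "P m = Q m" using e l by (metis smult_eq_iff)
qed

text \<open>The terminating series form a family, being orthogonal for distinct eigenvalues.
  Uniqueness identifies it with the description \<open>jacobi\<close>, which thereby inherits the
  equation.\<close>

lemma jacobi_is_family: "is_jacobi_family \<alpha> \<beta> (jacobi \<alpha> \<beta>)"
  and jacobi_satisfies_ode: "jacobi_ode \<alpha> \<beta> (jacobi_eigenvalue \<alpha> \<beta> m) (jacobi \<alpha> \<beta> m)"
proof -
  obtain Q where Q: "\<And>m. jacobi_ode \<alpha> \<beta> (jacobi_eigenvalue \<alpha> \<beta> m) (Q m) \<and> degree (Q m) = m
      \<and> poly (Q m) 1 = (real m + \<alpha>) gchoose m"
    using jacobi_ode_solution_exists[OF exponents] by metis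
  have QF: "is_jacobi_family \<alpha> \<beta> Q"
    unfolding jacobi_family_iff using Q jacobi_ode_orthogonal jacobi_eigenvalue_inj by metis
  then have "jacobi \<alpha> \<beta> = Q"
    unfolding jacobi_def using jacobi_family_unique by blast
  then show "is_jacobi_family \<alpha> \<beta> (jacobi \<alpha> \<beta>)"
    "jacobi_ode \<alpha> \<beta> (jacobi_eigenvalue \<alpha> \<beta> m) (jacobi \<alpha> \<beta> m)" using QF Q by auto
qed

end

section \<open>Roots and Radau nodes\<close>

text \<open>\<open>energy_comparable\<close> spreads a zero of the energy over (-1, 1). This plays
  the part of uniqueness for initial value problems and makes the energy at 0 a positive
  scale.\<close>

lemma jacobi_ode_energy_zero:
  assumes ode: "jacobi_ode \<alpha> \<beta> lam y" and lam: "lam > 0" and x0: "\<bar>x0\<bar> < 1"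
    and E: "energy \<alpha> \<beta> lam y x0 \<le> 0"
  shows "y = 0"
proof -
  have "poly y x = 0" if x: "x \<in> {-1<..<1}" for x
  proof -
    have x1: "\<bar>x\<bar> < 1" using x by auto
    have D: "1 - x\<^sup>2 > 0" using x1 by (simp add: abs_square_less_1)
    have "energy \<alpha> \<beta> lam y x \<le> 0"
      using energy_comparable[OF ode lam x1 x0] E
      by (meson exp_ge_zero mult_nonpos_nonneg order_trans)
    then have "((1 - x\<^sup>2) * poly (pderiv y) x - energy_slope \<alpha> \<beta> x * poly y x)\<^sup>2 / (1 - x\<^sup>2)
       + lam * (poly y x)\<^sup>2 \<le> 0"
      unfolding energy_def using x by (simp add: mult_le_0_iff)
    moreover have "((1 - x\<^sup>2) * poly (pderiv y) x - energy_slope \<alpha> \<beta> x * poly y x)\<^sup>2 / (1 - x\<^sup>2) \<ge> 0"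
      using D by simp
    ultimately have "lam * (poly y x)\<^sup>2 \<le> 0" by linarith
    then show ?thesis using lam by (simp add: mult_le_0_iff)
  qed
  then have "{-1<..<1} \<subseteq> {x. poly y x = 0}" by auto
  moreover have "infinite {-1<..<(1::real)}" by simp
  ultimately show "y = 0" using finite_subset poly_roots_finite by blast
qed

text \<open>At a double root the energy would vanish.\<close>

lemma jacobi_ode_simple_root:
  assumes "jacobi_ode \<alpha> \<beta> lam y" "lam > 0" "y \<noteq> 0" "\<bar>x\<bar> < 1" "poly y x = 0"
  shows "poly (pderiv y) x \<noteq> 0"
proof
  assume "poly (pderiv y) x = 0"
  then have "energy \<alpha> \<beta> lam y x \<le> 0" using assms(5) by (simp add: energy_def)
  then show False using jacobi_ode_energy_zero assms by blast
qed

lemma prod_linear_factors_dvd: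
  fixes y :: "'a :: field poly"
  assumes "finite R" "\<And>r. r \<in> R \<Longrightarrow> poly y r = 0"
  shows "(\<Prod>r\<in>R. [:- r, 1:]) dvd y"
  using assms
proof (induction R rule: finite_induct)
  case (insert r R)
  then obtain h where h: "y = (\<Prod>r\<in>R. [:- r, 1:]) * h" by (auto elim: dvdE)
  have "poly (\<Prod>r\<in>R. [:- r, 1:]) r \<noteq> 0" using insert by (auto simp: poly_prod)
  then have "poly h r = 0" using insert.prems[of r] h by simp
  then have "[:- r, 1:] dvd h" by (simp add: poly_eq_0_iff_dvd)
  then have "[:- r, 1:] * (\<Prod>r\<in>R. [:- r, 1:]) dvd h * (\<Prod>r\<in>R. [:- r, 1:])"
    by (intro mult_dvd_mono) auto
  then show ?case using insert.hyps by (simp only: prod.insert h mult.commute[of _ h] not_False_eq_True)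
qed simp

lemma degree_prod_linear_factors: "degree (\<Prod>r\<in>R. [:- r, 1 :: 'a :: field:]) = card R"
proof (cases "finite R")
  case True
  then have "degree (\<Prod>r\<in>R. [:- r, 1 :: 'a:]) = (\<Sum>r\<in>R. degree [:- r, 1 :: 'a:])"
    by (intro degree_prod_eq_sum_degree) auto
  then show ?thesis by simp
qed simp

text \<open>The classical sign argument: with \<open>q\<close> the product over the roots in (-1,
  1), simplicity leaves a cofactor \<open>h\<close> without zeros there, so y q = h q^2 has constant
  sign. If \<open>q\<close> had degree below \<open>m\<close>, orthogonality would make its integral
  zero.\<close>

lemma jacobi_roots:
  assumes "\<alpha> > -1" "\<beta> > -1"
  shows "{x. poly (jacobi \<alpha> \<beta> m) x = 0} \<subseteq> {-1<..<1}" and "card {x. poly (jacobi \<alpha> \<beta> m) x = 0} = m"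
proof -
  let ?y = "jacobi \<alpha> \<beta> m"
  note fam = jacobi_is_family[OF assms] and ode = jacobi_satisfies_ode[OF assms, of m]
  have deg: "degree ?y = m" using fam by (simp add: is_jacobi_family_def)
  have "poly ?y 1 > 0"
    using fam gbinomial_shift_pos[OF assms(1), of m] by (simp add: is_jacobi_family_def)
  then have y0: "?y \<noteq> 0" by auto
  define R where "R = {x. poly ?y x = 0} \<inter> {-1<..<1}"
  have fin: "finite R" using poly_roots_finite[OF y0] by (simp add: R_def)
  define q where "q = (\<Prod>r\<in>R. [:- r, 1:])"
  have qdeg: "degree q = card R" by (simp add: q_def degree_prod_linear_factors)
  have q0: "q \<noteq> 0" using fin by (auto simp: q_def)
  have qr: "poly q x = 0 \<longleftrightarrow> x \<in> R" for x using fin by (auto simp: q_def poly_prod)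
  have "q dvd ?y" unfolding q_def using fin by (rule prod_linear_factors_dvd) (auto simp: R_def)
  then obtain h where h: "?y = q * h" by (auto elim: dvdE)
  have h_nz: "poly h x \<noteq> 0" if x: "x \<in> {-1<..<1}" for x
  proof
    assume h0: "poly h x = 0"
    then have yx: "poly ?y x = 0" by (simp add: h)
    then have "x \<in> R" using x by (simp add: R_def)
    then have "poly q x = 0" by (simp add: qr)
    then have "poly (pderiv ?y) x = 0" using h0 by (simp add: h pderiv_mult)
    moreover have "m \<noteq> 0"
    proof
      assume "m = 0"
      then have "degree ?y = 0" using deg by simp
      then obtain c where "?y = [:c:]" by (rule degree_eq_zeroE)
      then show False using yx y0 by simp
    qed
    then have "jacobi_eigenvalue \<alpha> \<beta> m > 0"
      using assms by (auto simp: jacobi_eigenvalue_def intro!: mult_pos_pos)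
    ultimately show False using jacobi_ode_simple_root[OF ode _ y0 _ yx] x by (auto simp: abs_less_iff)
  qed
  have sign: "poly h s > 0 \<Longrightarrow> poly h t > 0" if st: "s \<in> {-1<..<1}" "t \<in> {-1<..<1}" for s t
  proof (rule ccontr)
    assume "poly h s > 0" "\<not> poly h t > 0"
    then have "poly h s > 0" "poly h t < 0" using h_nz[OF st(2)] by auto
    then obtain u where u: "min s t < u" "u < max s t" "poly h u = 0"
      using poly_IVT_neg[of s t h] poly_IVT_pos[of t s h] by (cases s t rule: linorder_cases) auto
    then have "u \<in> {-1<..<1}" using st by (auto simp: min_def max_def split: if_splits)
    then show False using h_nz u(3) by blast
  qed
  have "card R = m"
  proof (rule antisym)
    have "card R \<le> card {x. poly ?y x = 0}" using poly_roots_finite[OF y0] by (intro card_mono) (auto simp: R_def)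
    also have "\<dots> \<le> m" using card_poly_roots_bound[OF y0] deg by simp
    finally show "card R \<le> m" .
    show "m \<le> card R"
    proof (rule ccontr)
      assume "\<not> m \<le> card R"
      then have "jacobi_integral \<alpha> \<beta> (?y * q) = 0"
        by (intro jacobi_family_orthogonal_lower_degree[OF assms fam]) (simp add: qdeg)
      then have i: "jacobi_integral \<alpha> \<beta> (smult c (?y * q)) = 0" for c
        by (simp add: jacobi_integral_smult[OF assms])
      define c :: real where "c = (if poly h 0 > 0 then 1 else - 1)"
      have "c * poly h t > 0" if "t \<in> {-1<..<1}" for t
        using sign[of t 0] sign[of 0 t] h_nz[OF that] that
        by (auto simp: c_def neq_iff)
      then have "poly (smult c (?y * q)) t \<ge> 0" if "t \<in> {-1<..<1}" for t
      proof -
        have *: "poly (smult c (?y * q)) t = (c * poly h t) * (poly q t)\<^sup>2"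
          by (simp add: h power2_eq_square)
        have "c * poly h t \<ge> 0" using \<open>\<And>t. t \<in> {-1<..<1} \<Longrightarrow> c * poly h t > 0\<close>[OF that] by simp
        then show ?thesis unfolding * by (rule mult_nonneg_nonneg) simp
      qed
      then have "smult c (?y * q) = 0" using i by (intro jacobi_integral_eq_0_imp[OF assms]) auto
      then show False using y0 q0 by (auto simp: c_def split: if_splits)
    qed
  qed
  moreover have "card {x. poly ?y x = 0} \<le> m" using card_poly_roots_bound[OF y0] deg by simp
  ultimately have eq: "R = {x. poly ?y x = 0}"
    using poly_roots_finite[OF y0] by (intro card_seteq) (auto simp: R_def)
  then show "{x. poly ?y x = 0} \<subseteq> {-1<..<1}" by (auto simp: R_def)
  show "card {x. poly ?y x = 0} = m" using eq \<open>card R = m\<close> by simp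
qed

text \<open>The factor \<open>c\<close> cancels; it permits (1 + x) times the Jacobi polynomial in
  place of the monic node polynomial. The node itself is treated apart, where the quotient would be
  0/0.\<close>

lemma lagrange_basis_eval:
  assumes inj: "inj_on x {1..n}" and k: "k \<in> {1..n}"
  shows "poly (lagrange_basis n x k) (x k) = 1"
    and "t \<noteq> x k \<Longrightarrow> c \<noteq> 0 \<Longrightarrow> poly (lagrange_basis n x k) t =
      poly (smult c (node_poly n x)) t / (poly (pderiv (smult c (node_poly n x))) (x k) * (t - x k))"
proof -
  define g where "g = (\<Prod>i\<in>{1..n} - {k}. [:- x i, 1:])"
  have np: "node_poly n x = [:- x k, 1:] * g"
    unfolding node_poly_def g_def using k by (intro prod.remove) auto
  have "poly [:- x i, 1:] (x k) \<noteq> 0" if "i \<in> {1..n} - {k}" for i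
    using inj_onD[OF inj, of i k] that k by auto
  then have "poly g (x k) \<noteq> 0"
    unfolding g_def poly_prod by (subst prod_zero_iff) blast+
  moreover have p: "poly (pderiv (node_poly n x)) (x k) = poly g (x k)"
    unfolding np pderiv_mult by (simp add: pderiv_pCons)
  moreover have "node_poly n x div [:- x k, 1:] = g"
    unfolding np by (rule nonzero_mult_div_cancel_left) simp
  then have l: "lagrange_basis n x k = smult (1 / poly g (x k)) g"
    unfolding lagrange_basis_def p by simp
  ultimately show "poly (lagrange_basis n x k) (x k) = 1" unfolding l by simp
  show "poly (lagrange_basis n x k) t =
      poly (smult c (node_poly n x)) t / (poly (pderiv (smult c (node_poly n x))) (x k) * (t - x k))"
    if "t \<noteq> x k" "c \<noteq> 0"
  proof -
    have "poly (node_poly n x) t = (t - x k) * poly g t" by (simp add: np algebra_simps)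
    then show ?thesis using that by (simp add: l pderiv_smult p)
  qed
qed

text \<open>-1 is not a root of the Jacobi polynomial, so there are exactly \<open>n\<close>
  distinct nodes. The product of their linear factors thus has the full degree of (1 + x) y, and the
  cofactor is constant.\<close>

lemma radau_nodes:
  assumes "\<alpha> > -1" "\<beta> > -1" "n \<ge> 1"
  defines "y \<equiv> jacobi \<alpha> \<beta> (n - 1)"
  shows "bij_betw (radau_node \<alpha> \<beta> n) {1..n} (insert (-1) {x. poly y x = 0})"
    and "\<exists>c. c \<noteq> 0 \<and> [:1, 1:] * y = smult c (node_poly n (radau_node \<alpha> \<beta> n))"
proof -
  let ?x = "radau_node \<alpha> \<beta> n"
  define N where "N = {x. poly ([:1, 1:] * y) x = 0}"
  have N: "N = insert (-1) {x. poly y x = 0}"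
  proof -
    have "poly ([:1, 1:] * y) x = (1 + x) * poly y x" for x by (simp add: algebra_simps)
    then show ?thesis unfolding N_def by auto
  qed
  have deg: "degree y = n - 1" and "poly y 1 > 0"
    using jacobi_is_family[OF assms(1,2)] gbinomial_shift_pos[OF assms(1), of "n - 1"]
    by (simp_all add: is_jacobi_family_def y_def)
  then have y0: "y \<noteq> 0" by auto
  have fin: "finite N" unfolding N using poly_roots_finite[OF y0] by simp
  have cN: "card N = n"
    unfolding N using jacobi_roots[OF assms(1,2), of "n - 1"] poly_roots_finite[OF y0] assms(3)
    by (subst card_insert_disjoint) (auto simp: y_def)
  have "bij_betw ((!) (sorted_list_of_set N)) {..<n} N"
    using fin cN by (intro bij_betw_nth) auto
  moreover have "bij_betw (\<lambda>k. k - 1) {1..n} {..<n}"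
    by (rule bij_betw_byWitness[of _ Suc]) (auto simp: image_iff)
  ultimately have "bij_betw ((!) (sorted_list_of_set N) \<circ> (\<lambda>k. k - 1)) {1..n} N"
    by (rule bij_betw_trans[rotated])
  moreover have "(!) (sorted_list_of_set N) \<circ> (\<lambda>k. k - 1) = ?x"
    by (simp add: fun_eq_iff radau_node_def N_def y_def)
  ultimately have bij: "bij_betw ?x {1..n} N" by simp
  then show "bij_betw ?x {1..n} (insert (-1) {x. poly y x = 0})" by (simp add: N)
  have np: "node_poly n ?x = (\<Prod>r\<in>N. [:- r, 1:])"
    unfolding node_poly_def using bij by (rule prod.reindex_bij_betw[of _ _ _ "\<lambda>r. [:- r, 1:]"])
  have "node_poly n ?x dvd [:1, 1:] * y"
    unfolding np using fin by (rule prod_linear_factors_dvd) (simp add: N_def)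
  then obtain h where h: "[:1, 1:] * y = node_poly n ?x * h" by (auto elim: dvdE)
  have f0: "[:1, 1:] * y \<noteq> 0" using y0 by (simp del: mult_pCons_left)
  then have "h \<noteq> 0" "node_poly n ?x \<noteq> 0" by (auto simp: h simp del: mult_pCons_left)
  have "degree ([:1, 1:] * y) = n" using y0 deg assms(3) by (subst degree_mult_eq) auto
  moreover have "degree (node_poly n ?x) = n" by (simp add: np degree_prod_linear_factors cN)
  ultimately have "degree h = 0"
    using \<open>h \<noteq> 0\<close> \<open>node_poly n ?x \<noteq> 0\<close> by (simp add: h degree_mult_eq del: mult_pCons_left)
  then obtain c where "h = [:c:]" by (rule degree_eq_zeroE)
  then show "\<exists>c. c \<noteq> 0 \<and> [:1, 1:] * y = smult c (node_poly n ?x)"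
    using h \<open>h \<noteq> 0\<close> by (intro exI[of _ c]) (simp del: mult_pCons_left)
qed

section \<open>Bounds for the Lagrange polynomials\<close>

text \<open>The bounds at 1 for y and for its reflection are glued at 0. On each half the shifted
  distance to the other end lies in [1, 4], so inserting its power costs only the constant
  \<open>H\<close>.\<close>

lemma jacobi_ode_global_bounds:
  assumes al: "\<alpha> > -1" and be: "\<beta> > -1"
  defines "a \<equiv> \<alpha> + 1/2" and "b \<equiv> \<beta> + 1/2"
  shows "\<exists>C lam0. C \<ge> 1 \<and> lam0 \<ge> 1 \<and> (\<forall>lam\<ge>lam0. \<forall>y. jacobi_ode \<alpha> \<beta> lam y \<longrightarrow> y \<noteq> 0 \<longrightarrow>
    (\<exists>S>0. S * lam powr (b - 1) \<le> C * (poly y (-1))\<^sup>2 \<and> (\<forall>x\<in>{-1..1}.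
      lam * (poly y x)\<^sup>2 \<le> C * S * ((1 - x + 1/lam) powr - a * (1 + x + 1/lam) powr - b) \<and>
      (poly (pderiv y) x)\<^sup>2 \<le> C * S * ((1 - x + 1/lam) powr (- a - 1) * (1 + x + 1/lam) powr (- b - 1)) \<and>
      (poly y x = 0 \<longrightarrow>
         S * ((1 - x + 1/lam) powr (- a - 1) * (1 + x + 1/lam) powr (- b - 1)) \<le> C * (poly (pderiv y) x)\<^sup>2 \<and>
         1 + x + 1/lam \<le> C * (1 + x)))))"
proof -
  obtain C1 l1 where C1: "C1 \<ge> 1" "l1 \<ge> 1" "\<And>lam y. lam \<ge> l1 \<Longrightarrow> jacobi_ode \<alpha> \<beta> lam y \<Longrightarrow>
      edge_bounds C1 a (energy \<alpha> \<beta> lam y 0) lam y"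
    using jacobi_ode_edge_bounds[OF al be] unfolding a_def by blast
  obtain C2 l2 where C2: "C2 \<ge> 1" "l2 \<ge> 1" "\<And>lam y. lam \<ge> l2 \<Longrightarrow> jacobi_ode \<beta> \<alpha> lam y \<Longrightarrow>
      edge_bounds C2 b (energy \<beta> \<alpha> lam y 0) lam y"
    using jacobi_ode_edge_bounds[OF be al] unfolding b_def by blast
  define H where "H = 4 powr (\<bar>a\<bar> + \<bar>b\<bar> + 1)"
  have H: "H \<ge> 1" by (simp add: H_def ge_one_powr_ge_zero)
  define c where "c = max 2 (max C1 C2)"
  have c: "c \<ge> C1" "c \<ge> C2" "c \<ge> 2" by (auto simp: c_def)
  define C where "C = c * H"
  have "c * 1 \<le> C" unfolding C_def using H c by (intro mult_left_mono) auto
  then have C: "C \<ge> c" by simp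
  have pH: "u powr p \<le> H" "1 \<le> H * u powr p"
    if "u \<in> {1..4}" "p \<in> {- a, - b, - a - 1, - b - 1}" for u p
  proof -
    have "4 powr \<bar>p\<bar> \<le> H" unfolding H_def using that by (intro powr_mono) auto
    moreover have "u powr p \<le> 4 powr \<bar>p\<bar>" "1 \<le> 4 powr \<bar>p\<bar> * u powr p"
      using powr_le_powr_of_comparable[of u 1 4 p] powr_le_powr_of_comparable[of 1 u 4 p] that by auto
    moreover have "4 powr \<bar>p\<bar> * u powr p \<le> H * u powr p" using calculation(1) by (rule mult_right_mono) simp
    ultimately show "u powr p \<le> H" "1 \<le> H * u powr p" by linarith+
  qed
  have "\<exists>S>0. S * lam powr (b - 1) \<le> C * (poly y (-1))\<^sup>2 \<and> (\<forall>x\<in>{-1..1}.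
      lam * (poly y x)\<^sup>2 \<le> C * S * ((1 - x + 1/lam) powr - a * (1 + x + 1/lam) powr - b) \<and>
      (poly (pderiv y) x)\<^sup>2 \<le> C * S * ((1 - x + 1/lam) powr (- a - 1) * (1 + x + 1/lam) powr (- b - 1)) \<and>
      (poly y x = 0 \<longrightarrow>
         S * ((1 - x + 1/lam) powr (- a - 1) * (1 + x + 1/lam) powr (- b - 1)) \<le> C * (poly (pderiv y) x)\<^sup>2 \<and>
         1 + x + 1/lam \<le> C * (1 + x)))"
    if lam: "lam \<ge> max l1 l2" and ode: "jacobi_ode \<alpha> \<beta> lam y" and y: "y \<noteq> 0" for lam y
  proof -
    define S where "S = energy \<alpha> \<beta> lam y 0"
    have l: "lam \<ge> 1" "1 / lam \<le> 1" "1 / lam > 0" using lam C1 by auto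
    have S: "S > 0" unfolding S_def using jacobi_ode_energy_zero[OF ode _ _ ] y l by (metis abs_zero less_le_trans not_le zero_less_one)
    define yr where "yr = y \<circ>\<^sub>p [:0, - 1:]"
    have yr: "poly yr x = poly y (- x)" "(poly (pderiv yr) x)\<^sup>2 = (poly (pderiv y) (- x))\<^sup>2" for x
      by (simp_all add: yr_def pderiv_reflect poly_pcompose)
    have R: "edge_bounds c a S lam y"
      using edge_bounds_mono[OF C1(3)[OF _ ode] c(1)] lam S unfolding S_def by simp
    have "energy \<beta> \<alpha> lam yr 0 = S" by (simp add: yr_def energy_reflect S_def)
    then have L: "edge_bounds c b S lam yr"
      using edge_bounds_mono[OF C2(3)[OF _ jacobi_ode_reflect[OF ode]] c(2)] lam S unfolding yr_def by simp
    \<comment> \<open>\<open>u\<close> is the shifted distance to the nearer end, \<open>v\<close>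
      the one to the farther end; \<open>ab\<close> covers both halves at once.\<close>
    have main: "lam * (poly y x)\<^sup>2 \<le> C * S * (A powr - a * B powr - b) \<and>
      (poly (pderiv y) x)\<^sup>2 \<le> C * S * (A powr (- a - 1) * B powr (- b - 1)) \<and>
      (poly y x = 0 \<longrightarrow> S * (A powr (- a - 1) * B powr (- b - 1)) \<le> C * (poly (pderiv y) x)\<^sup>2)"
      if h: "lam * (poly y x)\<^sup>2 \<le> c * S * u powr - p"
         "(poly (pderiv y) x)\<^sup>2 \<le> c * S * u powr (- p - 1)"
         "poly y x = 0 \<longrightarrow> S * u powr (- p - 1) \<le> c * (poly (pderiv y) x)\<^sup>2"
      and uv: "v \<in> {1..4}"
      and ab: "(u = A \<and> p = a \<and> v = B \<and> q = b) \<or> (u = B \<and> p = b \<and> v = A \<and> q = a)" for x u v A B p q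
    proof -
      have q: "- q \<in> {- a, - b, - a - 1, - b - 1}" "- q - 1 \<in> {- a, - b, - a - 1, - b - 1}" using ab by auto
      have e: "A powr - a * B powr - b = u powr - p * v powr - q"
        "A powr (- a - 1) * B powr (- b - 1) = u powr (- p - 1) * v powr (- q - 1)" using ab by auto
      have up: "c * S * u powr r \<le> C * S * (u powr r * v powr s)" if "1 \<le> H * v powr s" for r s
      proof -
        have "c * S * u powr r * 1 \<le> c * S * u powr r * (H * v powr s)"
          using that c S by (intro mult_left_mono) auto
        then show ?thesis by (simp add: C_def mult_ac)
      qed
      have "S * (u powr (- p - 1) * v powr (- q - 1)) \<le> C * (poly (pderiv y) x)\<^sup>2" if "poly y x = 0"
      proof -
        have "(S * u powr (- p - 1)) * v powr (- q - 1) \<le> (c * (poly (pderiv y) x)\<^sup>2) * H"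
          using h(3) that pH(1)[OF uv q(2)] c
          by (intro mult_mono[of "S * u powr (- p - 1)"]) auto
        then show ?thesis by (simp add: C_def mult_ac)
      qed
      then show ?thesis unfolding e
        using order_trans[OF h(1) up[OF pH(2)[OF uv q(1)]]] order_trans[OF h(2) up[OF pH(2)[OF uv q(2)]]] by blast
    qed
    have all: "lam * (poly y x)\<^sup>2 \<le> C * S * ((1 - x + 1/lam) powr - a * (1 + x + 1/lam) powr - b) \<and>
      (poly (pderiv y) x)\<^sup>2 \<le> C * S * ((1 - x + 1/lam) powr (- a - 1) * (1 + x + 1/lam) powr (- b - 1)) \<and>
      (poly y x = 0 \<longrightarrow>
         S * ((1 - x + 1/lam) powr (- a - 1) * (1 + x + 1/lam) powr (- b - 1)) \<le> C * (poly (pderiv y) x)\<^sup>2) \<and>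
         (poly y x = 0 \<longrightarrow> 1 + x + 1/lam \<le> C * (1 + x))"
      if x: "x \<in> {-1..1}" for x
    proof (cases "x \<ge> 0")
      case True
      then have x01: "x \<in> {0..1}" using x by auto
      have v: "1 + x + 1/lam \<in> {1..4}" using x01 l unfolding atLeastAtMost_iff by linarith
      have "1 + x + 1/lam \<le> 2 * (1 + x)" using l True by (simp only: distrib_left)
      also have "\<dots> \<le> C * (1 + x)" using c C x01 by (intro mult_right_mono) auto
      finally have "1 + x + 1/lam \<le> C * (1 + x)" .
      moreover have "lam * (poly y x)\<^sup>2 \<le> c * S * (1 - x + 1/lam) powr - a"
         "(poly (pderiv y) x)\<^sup>2 \<le> c * S * (1 - x + 1/lam) powr (- a - 1)"
         "poly y x = 0 \<longrightarrow> S * (1 - x + 1/lam) powr (- a - 1) \<le> c * (poly (pderiv y) x)\<^sup>2"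
        using R S x01 unfolding edge_bounds_def by auto
      ultimately show ?thesis using main[of x "1 - x + 1/lam" a "1 + x + 1/lam" "1 - x + 1/lam" "1 + x + 1/lam" b] v
        by blast
    next
      case False
      then have x01: "- x \<in> {0..1}" using x by auto
      have v: "1 - x + 1/lam \<in> {1..4}" using x01 l unfolding atLeastAtMost_iff by linarith
      have L': "lam * (poly y x)\<^sup>2 \<le> c * S * (1 + x + 1/lam) powr - b"
         "(poly (pderiv y) x)\<^sup>2 \<le> c * S * (1 + x + 1/lam) powr (- b - 1)"
         "poly y x = 0 \<longrightarrow> S * (1 + x + 1/lam) powr (- b - 1) \<le> c * (poly (pderiv y) x)\<^sup>2"
         "poly y x = 0 \<longrightarrow> 1 + x + 1/lam \<le> c * (1 + x)"
        using L S bspec[OF conjunct1[OF L[unfolded edge_bounds_def]] x01] by (auto simp: yr)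
      have "c * (1 + x) \<le> C * (1 + x)" using C x by (intro mult_right_mono) auto
      then have "poly y x = 0 \<longrightarrow> 1 + x + 1/lam \<le> C * (1 + x)" using L'(4) by auto
      then show ?thesis using main[of x "1 + x + 1/lam" b "1 - x + 1/lam" "1 - x + 1/lam" "1 + x + 1/lam" a] v L'
        by blast
    qed
    have "S * lam powr (b - 1) \<le> c * (poly y (-1))\<^sup>2"
      using L unfolding edge_bounds_def by (simp add: yr)
    also have "\<dots> \<le> C * (poly y (-1))\<^sup>2" using C by (rule mult_right_mono) auto
    finally show ?thesis using S all by blast
  qed
  moreover have "C \<ge> 1" "max l1 l2 \<ge> 1" using C c C1 by auto
  ultimately show ?thesis by blast
qed

section \<open>Comparison of powers of the distances to 1 and -1\<close>

lemma powr_le_of_mem_Icc: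
  fixes u p s lam :: real
  assumes lam: "lam \<ge> 1" and u: "u \<in> {1/lam..4}" and s: "0 \<le> s" "- p \<le> s"
  shows "u powr p \<le> 4 powr \<bar>p\<bar> * lam powr s"
proof (cases "p \<ge> 0")
  case True
  have "1 / lam > 0" using lam by simp
  then have "u > 0" using u less_le_trans unfolding atLeastAtMost_iff by blast
  then have "u powr p \<le> 4 powr p" using u True by (intro powr_mono2) auto
  also have "\<dots> * 1 \<le> 4 powr p * lam powr s"
    using lam s by (intro mult_left_mono ge_one_powr_ge_zero) auto
  finally show ?thesis using True by simp
next
  case False
  \<comment> \<open>A negative exponent is worst at the left end \<open>1/lam\<close>.\<close>
  have "u powr p \<le> (1/lam) powr p" using u False lam by (intro powr_mono2') auto
  also have "\<dots> = lam powr - p" using lam by (simp add: powr_divide powr_minus_divide)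
  also have "\<dots> \<le> lam powr s" using s lam by (intro powr_mono) auto
  also have "\<dots> \<le> 4 powr \<bar>p\<bar> * lam powr s"
    using mult_right_mono[of 1 "4 powr \<bar>p\<bar>" "lam powr s"] by (simp add: ge_one_powr_ge_zero)
  finally show ?thesis .
qed

text \<open>\<open>A\<close>, \<open>B\<close> are the shifted distances of the evaluation point t
  to 1 and -1, \<open>A'\<close>, \<open>B'\<close> those of the node x, and \<open>d\<close> is |t
  - x|. The left side is the upper weight for lam ((1 + t) y(t))^2 divided by the lower weight for
  ((1 + x) y'(x))^2. So the claim bounds the square of a Lagrange polynomial by lam^e when t is not
  too close to x.\<close>

lemma weight_ratio_bound:
  fixes a b e :: real
  assumes a: "a + 1 > 0" and e: "0 \<le> e" "b - 3 \<le> e" "a - 1 \<le> e" "b \<le> 1 \<Longrightarrow> - b \<le> e \<and> a - b \<le> e"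
  shows "\<exists>C\<ge>1. \<forall>lam A B A' B' d. lam \<ge> 1 \<longrightarrow> A \<in> {1/lam..4} \<longrightarrow> B \<in> {1/lam..4} \<longrightarrow>
     A' \<in> {1/lam..4} \<longrightarrow> B' \<in> {1/lam..4} \<longrightarrow> A + B \<ge> 2 \<longrightarrow> A' + B' \<ge> 2 \<longrightarrow>
     \<bar>A - A'\<bar> = d \<longrightarrow> \<bar>B - B'\<bar> = d \<longrightarrow> min A' B' \<le> 2 * d \<longrightarrow>
     A powr - a * B powr (2 - b) * A' powr (a + 1) * B' powr (b - 1) \<le> C * lam powr (e + 1) * d\<^sup>2"
proof -
  define H where "H = 4 powr (\<bar>a\<bar> + \<bar>b\<bar> + 3)"
  have H: "H \<ge> 1" by (simp add: H_def ge_one_powr_ge_zero)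
  define C where "C = 9 * H ^ 4"
  have C1: "C \<ge> 1" using one_le_power[OF H, of 4] by (simp add: C_def)
  have "A powr - a * B powr (2 - b) * A' powr (a + 1) * B' powr (b - 1) \<le> C * lam powr (e + 1) * d\<^sup>2"
    if lam: "lam \<ge> 1" and AB: "A \<in> {1/lam..4}" "B \<in> {1/lam..4}" "A' \<in> {1/lam..4}" "B' \<in> {1/lam..4}"
      and sum: "A + B \<ge> 2" "A' + B' \<ge> 2" and d: "\<bar>A - A'\<bar> = d" "\<bar>B - B'\<bar> = d" "min A' B' \<le> 2 * d"
    for lam A B A' B' d
  proof -
    have lp: "1 / lam > 0" using lam by simp
    have gp: "u > 0" if "u \<in> {1/lam..4}" for u
      using less_le_trans[OF lp] that unfolding atLeastAtMost_iff by blast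
    have pos: "A > 0" "B > 0" "A' > 0" "B' > 0" using AB gp by blast+
    have d0: "d \<ge> 0" using d by auto
    have pH: "4 powr \<bar>p\<bar> \<le> H" if "\<bar>p\<bar> \<le> \<bar>a\<bar> + \<bar>b\<bar> + 3" for p
      unfolding H_def using that by (intro powr_mono) auto
    have pw: "u powr p \<le> H * lam powr s"
      if "u \<in> {1/lam..4}" "\<bar>p\<bar> \<le> \<bar>a\<bar> + \<bar>b\<bar> + 3" "0 \<le> s" "- p \<le> s" for u p s
      using powr_le_of_mem_Icc[OF lam that(1,3,4)] pH[OF that(2)]
      by (meson mult_right_mono order_trans powr_ge_zero)
    have pc: "u powr p \<le> H" if "u \<in> {1/2..4}" "\<bar>p\<bar> \<le> \<bar>a\<bar> + \<bar>b\<bar> + 3" for u p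
      using powr_le_powr_of_comparable[of u 1 4 p] pH[OF that(2)] that by auto
    \<comment> \<open>\<open>X * Y\<close> is the pair of factors that can be large;
      \<open>Z\<close> and \<open>W\<close> are harmless.\<close>
    have fin: ?thesis if "X * Y \<le> 9 * H ^ 2 * lam powr (e + 1) * d\<^sup>2"
        "A powr - a * B powr (2 - b) * A' powr (a + 1) * B' powr (b - 1) = X * Y * (Z * W)"
        "0 \<le> Z" "Z \<le> H" "0 \<le> W" "W \<le> H" "0 \<le> X" "0 \<le> Y" for X Y Z W
    proof -
      have "X * Y * (Z * W) \<le> (9 * H ^ 2 * lam powr (e + 1) * d\<^sup>2) * (H * H)"
        using that H by (intro mult_mono[of "X * Y"] mult_mono[of Z]) auto
      then show ?thesis unfolding that(2) by (simp add: C_def power2_eq_square power4_eq_xxxx mult_ac)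
    qed
    have inv: "u powr - 1 \<le> lam powr (e + 1)" if "u \<in> {1/lam..4}" for u
    proof -
      have "u powr - 1 \<le> (1/lam) powr - 1" using that lp by (intro powr_mono2') auto
      also have "\<dots> = lam powr 1" using lam by (simp add: powr_divide powr_minus_divide)
      also have "\<dots> \<le> lam powr (e + 1)" using lam e by (intro powr_mono) auto
      finally show ?thesis .
    qed
    have HH: "1 \<le> H\<^sup>2" "H \<le> H\<^sup>2" using H by (simp_all add: one_le_power self_le_power)
    have prod2: "u powr p * v powr q \<le> H\<^sup>2 * lam powr (e + 1)"
      if "u \<in> {1/lam..4}" "\<bar>p\<bar> \<le> \<bar>a\<bar> + \<bar>b\<bar> + 3" "v \<in> {1/lam..4}" "\<bar>q\<bar> \<le> \<bar>a\<bar> + \<bar>b\<bar> + 3"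
        "max 0 (- p) + max 0 (- q) \<le> e + 1" for u v p q
    proof -
      have "u powr p * v powr q \<le> (H * lam powr max 0 (- p)) * (H * lam powr max 0 (- q))"
        using pw[OF that(1,2), of "max 0 (- p)"] pw[OF that(3,4), of "max 0 (- q)"] H
        by (intro mult_mono) auto
      also have "\<dots> = H\<^sup>2 * lam powr (max 0 (- p) + max 0 (- q))"
        by (simp add: powr_add power2_eq_square)
      also have "\<dots> \<le> H\<^sup>2 * lam powr (e + 1)"
        using that(5) lam by (intro mult_left_mono powr_mono) auto
      finally show ?thesis .
    qed
    \<comment> \<open>Used with \<open>s = b\<close> near \<open>-1\<close> and with \<open>s = a + 2\<close> near \<open>1\<close>.\<close>
    have same: "u powr (2 - s) * u' powr (s - 1) \<le> 9 * H\<^sup>2 * lam powr (e + 1) * d\<^sup>2"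
      if u: "u \<in> {1/lam..4}" "u' \<in> {1/lam..4}" and du: "\<bar>u - u'\<bar> = d" "u' \<le> 2 * d"
        and s: "\<bar>2 - s\<bar> \<le> \<bar>a\<bar> + \<bar>b\<bar> + 3" "\<bar>s - 3\<bar> \<le> \<bar>a\<bar> + \<bar>b\<bar> + 3" "\<bar>s - 1\<bar> \<le> \<bar>a\<bar> + \<bar>b\<bar> + 3"
          "\<bar>s\<bar> \<le> \<bar>a\<bar> + \<bar>b\<bar> + 3" "s - 3 \<le> e" "s < 1 \<Longrightarrow> - s \<le> e"
      for u u' s
    proof (cases "u \<le> u'")
      case True
      have up: "u > 0" "u' > 0" using u gp by blast+
      \<comment> \<open>The product has total degree 1. The square of the larger variable, which is
        at most 3 \<open>d\<close>, is split off; the rest has degree -1 and either collapses to the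
        inverse of the larger variable or is estimated factor by factor.\<close>
      have "u powr (2 - s) * u' powr (s - 1) = u powr (2 - s) * u' powr (s - 3) * u'\<^sup>2"
        using up powr_add[of u' "s - 3" 2] by simp
      also have "\<dots> \<le> (H\<^sup>2 * lam powr (e + 1)) * u'\<^sup>2"
      proof (rule mult_right_mono)
        show "u powr (2 - s) * u' powr (s - 3) \<le> H\<^sup>2 * lam powr (e + 1)"
        proof (cases "s \<le> 2")
          case s2: True
          have "u powr (2 - s) * u' powr (s - 3) \<le> u' powr (2 - s) * u' powr (s - 3)"
            using up True s2 by (intro mult_right_mono powr_mono2) auto
          also have "\<dots> = u' powr - 1" using up by (simp add: powr_add[symmetric])
          also have "\<dots> \<le> lam powr (e + 1)" using inv u by blast
          also have "\<dots> \<le> H\<^sup>2 * lam powr (e + 1)" using HH mult_right_mono[of 1 "H\<^sup>2" "lam powr (e + 1)"] by simp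
          finally show ?thesis .
        next
          case False
          \<comment> \<open>Here \<open>s > 2\<close>: the powers of lam add up to
            \<open>s - 2\<close> plus the positive part of \<open>3 - s\<close>, within
            \<open>e + 1\<close> because \<open>0 \<le> e\<close> and
            \<open>s - 3 \<le> e\<close>.\<close>
          show ?thesis using u s e False by (intro prod2) auto
        qed
      qed simp
      also have "\<dots> \<le> 9 * H\<^sup>2 * lam powr (e + 1) * d\<^sup>2"
      proof -
        have "u' \<le> 3 * d" using du d0 by linarith
        then have "u'\<^sup>2 \<le> (3 * d)\<^sup>2" using up by (intro power_mono) auto
        then have "u'\<^sup>2 \<le> 9 * d\<^sup>2" by (simp add: power_mult_distrib)
        then have "(H\<^sup>2 * lam powr (e + 1)) * u'\<^sup>2 \<le> (H\<^sup>2 * lam powr (e + 1)) * (9 * d\<^sup>2)"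
          by (intro mult_left_mono) auto
        then show ?thesis by (simp add: mult_ac)
      qed
      finally show ?thesis .
    next
      case False
      have up: "u > 0" "u' > 0" using u gp by blast+
      have "u powr (2 - s) * u' powr (s - 1) = u powr - s * u' powr (s - 1) * u\<^sup>2"
        using up powr_add[of u "- s" 2] by simp
      also have "\<dots> \<le> (H\<^sup>2 * lam powr (e + 1)) * u\<^sup>2"
      proof (rule mult_right_mono)
        show "u powr - s * u' powr (s - 1) \<le> H\<^sup>2 * lam powr (e + 1)"
        proof (cases "s \<ge> 1")
          case s1: True
          have "u powr - s * u' powr (s - 1) \<le> u powr - s * u powr (s - 1)"
            using up False s1 by (intro mult_left_mono powr_mono2) auto
          also have "\<dots> = u powr - 1" using up by (simp add: powr_add[symmetric])
          also have "\<dots> \<le> lam powr (e + 1)" using inv u by blast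
          also have "\<dots> \<le> H\<^sup>2 * lam powr (e + 1)" using HH mult_right_mono[of 1 "H\<^sup>2" "lam powr (e + 1)"] by simp
          finally show ?thesis .
        next
          case False
          \<comment> \<open>Here \<open>s < 1\<close>, and the condition \<open>- s \<le> e\<close>
            keeps the powers of lam within \<open>e + 1\<close>.\<close>
          show ?thesis using u s e False by (intro prod2) auto
        qed
      qed simp
      also have "\<dots> \<le> 9 * H\<^sup>2 * lam powr (e + 1) * d\<^sup>2"
      proof -
        have "u \<le> 3 * d" using du False by linarith
        then have "u\<^sup>2 \<le> (3 * d)\<^sup>2" using up by (intro power_mono) auto
        then have "u\<^sup>2 \<le> 9 * d\<^sup>2" by (simp add: power_mult_distrib)
        then have "(H\<^sup>2 * lam powr (e + 1)) * u\<^sup>2 \<le> (H\<^sup>2 * lam powr (e + 1)) * (9 * d\<^sup>2)"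
          by (intro mult_left_mono) auto
        then show ?thesis by (simp add: mult_ac)
      qed
      finally show ?thesis .
    qed
    have far: "1 \<le> 9 * d\<^sup>2" if "d \<ge> 1/2"
      using power_mono[OF that, of 2] by (simp add: power2_eq_square)
    have cross: "u powr p * v powr q \<le> 9 * H\<^sup>2 * lam powr (e + 1) * d\<^sup>2"
      if "u \<in> {1/lam..4}" "\<bar>p\<bar> \<le> \<bar>a\<bar> + \<bar>b\<bar> + 3" "v \<in> {1/lam..4}" "\<bar>q\<bar> \<le> \<bar>a\<bar> + \<bar>b\<bar> + 3"
        "max 0 (- p) + max 0 (- q) \<le> e + 1" "d \<ge> 1/2" for u v p q
    proof -
      have "u powr p * v powr q \<le> H\<^sup>2 * lam powr (e + 1) * 1" using prod2[OF that(1-5)] by simp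
      also have "\<dots> \<le> H\<^sup>2 * lam powr (e + 1) * (9 * d\<^sup>2)"
        using far[OF that(6)] by (intro mult_left_mono) auto
      finally show ?thesis by (simp add: mult_ac)
    qed
    show ?thesis
    \<comment> \<open>The cases ask which end the node is nearer to, and then whether t is near the
      opposite end. If it is, \<open>d \<ge> 1/2\<close>, and no power of \<open>d\<close> has to be
      gained.\<close>
    proof (cases "A' \<le> B'")
      case True
      then have B': "B' \<ge> 1" "A' \<le> 2 * d" using sum d by auto
      show ?thesis
      proof (cases "B \<ge> 1/2")
        case B: True
        have "A powr (2 - (a + 2)) * A' powr ((a + 2) - 1) \<le> 9 * H\<^sup>2 * lam powr (e + 1) * d\<^sup>2"
          using AB d B' a e by (intro same) auto
        then have "A powr - a * A' powr (a + 1) \<le> 9 * H\<^sup>2 * lam powr (e + 1) * d\<^sup>2"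
          by (simp add: add.commute)
        then show ?thesis
          using AB B B' by (intro fin[of "A powr - a" "A' powr (a + 1)" "B powr (2 - b)" "B' powr (b - 1)"] pc) auto
      next
        case False
        then have Ad: "A \<ge> 1" "d \<ge> 1/2" using sum d B' by auto
        have "B powr (2 - b) * B' powr (b - 1) \<le> 9 * H\<^sup>2 * lam powr (e + 1) * d\<^sup>2"
        proof -
          have "B powr (2 - b) \<le> H * lam powr (e + 1)" using AB e by (intro pw) auto
          moreover have "B' powr (b - 1) \<le> H" using AB B' by (intro pc) auto
          ultimately have "B powr (2 - b) * B' powr (b - 1) \<le> (H * lam powr (e + 1)) * H"
            using H by (intro mult_mono) auto
          also have "\<dots> \<le> (H * lam powr (e + 1)) * H * (9 * d\<^sup>2)"
            using far[OF Ad(2)] H mult_left_mono[of 1 "9 * d\<^sup>2" "(H * lam powr (e + 1)) * H"] by simp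
          finally show ?thesis by (simp add: power2_eq_square mult_ac)
        qed
        moreover have "A' powr (a + 1) \<le> H"
        proof -
          have "A' powr (a + 1) \<le> 4 powr (a + 1)" using AB pos a by (intro powr_mono2) auto
          also have "\<dots> \<le> H" using pH[of "a + 1"] a by simp
          finally show ?thesis .
        qed
        moreover have "A powr - a \<le> H" using AB Ad by (intro pc) auto
        ultimately show ?thesis
          by (intro fin[of "B powr (2 - b)" "B' powr (b - 1)" "A powr - a" "A' powr (a + 1)"]) auto
      qed
    next
      case False
      then have A': "A' \<ge> 1" "B' \<le> 2 * d" using sum d by auto
      show ?thesis
      proof (cases "A \<ge> 1/2")
        case A: True
        have "B powr (2 - b) * B' powr (b - 1) \<le> 9 * H\<^sup>2 * lam powr (e + 1) * d\<^sup>2"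
          using AB d A' e by (intro same) auto
        then show ?thesis
          using AB A A' by (intro fin[of "B powr (2 - b)" "B' powr (b - 1)" "A powr - a" "A' powr (a + 1)"] pc) auto
      next
        case False
        then have Bd: "B \<ge> 1" "d \<ge> 1/2" using sum d A' by auto
        \<comment> \<open>With t near 1 and x near -1 the powers of lam add up to the positive parts
          of \<open>a\<close> and \<open>1 - b\<close>; this is where \<open>a - b \<le> e\<close>
          enters.\<close>
        have "A powr - a * B' powr (b - 1) \<le> 9 * H\<^sup>2 * lam powr (e + 1) * d\<^sup>2"
          using AB e Bd by (intro cross) (auto simp: max_def)
        then show ?thesis
          using AB Bd A' by (intro fin[of "A powr - a" "B' powr (b - 1)" "B powr (2 - b)" "A' powr (a + 1)"] pc) auto
      qed
    qed
  qed
  then show ?thesis using C1 by blast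
qed

text \<open>These are the squared bounds for the Lagrange polynomials y(t) / y(-1) of the node -1
  and of an interior node x, with the denominators multiplied out.\<close>

lemma jacobi_ode_radau_bounds:
  fixes e :: real
  assumes al: "\<alpha> > -1" and be: "\<beta> > -1"
    and e: "0 \<le> e" "\<beta> - 5/2 \<le> e" "\<alpha> - 1/2 \<le> e" "\<beta> \<le> 1/2 \<Longrightarrow> - \<beta> - 1/2 \<le> e \<and> \<alpha> - \<beta> \<le> e"
  shows "\<exists>K lam0. K \<ge> 1 \<and> lam0 \<ge> 1 \<and> (\<forall>lam\<ge>lam0. \<forall>y. jacobi_ode \<alpha> \<beta> lam y \<longrightarrow> y \<noteq> 0 \<longrightarrow>
     (\<forall>t\<in>{-1..1}. (poly y t)\<^sup>2 \<le> K * lam powr e * (poly y (-1))\<^sup>2 \<and>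
       (\<forall>x\<in>{-1<..<1}. poly y x = 0 \<longrightarrow>
          ((1 + t) * poly y t)\<^sup>2 \<le> K * lam powr e * ((1 + x) * poly (pderiv y) x * (t - x))\<^sup>2)))"
proof -
  define a b where "a = \<alpha> + 1/2" and "b = \<beta> + 1/2"
  obtain C lam0 where C: "C \<ge> 1" "lam0 \<ge> 1" and
    G: "\<And>lam y. lam \<ge> lam0 \<Longrightarrow> jacobi_ode \<alpha> \<beta> lam y \<Longrightarrow> y \<noteq> 0 \<Longrightarrow>
    \<exists>S>0. S * lam powr (b - 1) \<le> C * (poly y (-1))\<^sup>2 \<and> (\<forall>x\<in>{-1..1}.
      lam * (poly y x)\<^sup>2 \<le> C * S * ((1 - x + 1/lam) powr - a * (1 + x + 1/lam) powr - b) \<and>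
      (poly (pderiv y) x)\<^sup>2 \<le> C * S * ((1 - x + 1/lam) powr (- a - 1) * (1 + x + 1/lam) powr (- b - 1)) \<and>
      (poly y x = 0 \<longrightarrow>
         S * ((1 - x + 1/lam) powr (- a - 1) * (1 + x + 1/lam) powr (- b - 1)) \<le> C * (poly (pderiv y) x)\<^sup>2 \<and>
         1 + x + 1/lam \<le> C * (1 + x)))"
    using jacobi_ode_global_bounds[OF al be] unfolding a_def b_def by blast
  have "a + 1 > 0" "b - 3 \<le> e" "a - 1 \<le> e" "b \<le> 1 \<Longrightarrow> - b \<le> e \<and> a - b \<le> e"
    using al be e by (auto simp: a_def b_def)
  note ab = this
  obtain C0 where C0: "C0 \<ge> 1" and ratio: "\<And>lam A B A' B' d. lam \<ge> 1 \<Longrightarrow> A \<in> {1/lam..4} \<Longrightarrow> B \<in> {1/lam..4} \<Longrightarrow>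
     A' \<in> {1/lam..4} \<Longrightarrow> B' \<in> {1/lam..4} \<Longrightarrow> A + B \<ge> 2 \<Longrightarrow> A' + B' \<ge> 2 \<Longrightarrow>
     \<bar>A - A'\<bar> = d \<Longrightarrow> \<bar>B - B'\<bar> = d \<Longrightarrow> min A' B' \<le> 2 * d \<Longrightarrow>
     A powr - a * B powr (2 - b) * A' powr (a + 1) * B' powr (b - 1) \<le> C0 * lam powr (e + 1) * d\<^sup>2"
    using weight_ratio_bound[OF ab(1) e(1) ab(2-4)] by blast
  define H where "H = 4 powr \<bar>- a\<bar> * 4 powr \<bar>- b\<bar>"
  define H2 where "H2 = 2 powr \<bar>- a - 1\<bar> * 2 powr \<bar>- b - 1\<bar>"
  have H2: "H2 \<ge> 0" by (simp add: H2_def)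
  define K where "K = 1 + C\<^sup>2 * H + C ^ 4 * C0 + 4 * C ^ 4 * H2"
  have K: "K \<ge> 1" "K \<ge> C\<^sup>2 * H" "K \<ge> C ^ 4 * C0" "K \<ge> 4 * C ^ 4 * H2"
    using C C0 H2 by (auto simp: K_def H_def add_increasing add_increasing2)
  have main: "(poly y t)\<^sup>2 \<le> K * lam powr e * (poly y (-1))\<^sup>2"
      "\<And>x. x \<in> {-1<..<1} \<Longrightarrow> poly y x = 0 \<Longrightarrow>
          ((1 + t) * poly y t)\<^sup>2 \<le> K * lam powr e * ((1 + x) * poly (pderiv y) x * (t - x))\<^sup>2"
    if lam: "lam \<ge> lam0" and ode: "jacobi_ode \<alpha> \<beta> lam y" "y \<noteq> 0" and t: "t \<in> {-1..1}" for lam y t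
  proof -
    have l: "lam \<ge> 1" using lam C by simp
    have li: "0 < 1 / lam" "1 / lam \<le> 1" using l by auto
    obtain S where S: "S > 0" "S * lam powr (b - 1) \<le> C * (poly y (-1))\<^sup>2" and
      bd: "\<And>x. x \<in> {-1..1} \<Longrightarrow> lam * (poly y x)\<^sup>2 \<le> C * S * ((1 - x + 1/lam) powr - a * (1 + x + 1/lam) powr - b)"
      "\<And>x. x \<in> {-1..1} \<Longrightarrow> (poly (pderiv y) x)\<^sup>2 \<le> C * S * ((1 - x + 1/lam) powr (- a - 1) * (1 + x + 1/lam) powr (- b - 1))"
      "\<And>x. x \<in> {-1..1} \<Longrightarrow> poly y x = 0 \<Longrightarrow>
         S * ((1 - x + 1/lam) powr (- a - 1) * (1 + x + 1/lam) powr (- b - 1)) \<le> C * (poly (pderiv y) x)\<^sup>2"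
      "\<And>x. x \<in> {-1..1} \<Longrightarrow> poly y x = 0 \<Longrightarrow> 1 + x + 1/lam \<le> C * (1 + x)"
      using G[OF lam ode] by blast
    have rg: "1 - x + 1/lam \<in> {1/lam..4}" "1 + x + 1/lam \<in> {1/lam..4}" if "x \<in> {-1..1}" for x
      using that li unfolding atLeastAtMost_iff by linarith+
    have gp: "1 - x + 1/lam > 0" "1 + x + 1/lam > 0" if "x \<in> {-1..1}" for x
      using that li by (auto intro: add_nonneg_pos)
    have le1: "1 \<le> lam powr e" using l e by (intro ge_one_powr_ge_zero) auto
    show "(poly y t)\<^sup>2 \<le> K * lam powr e * (poly y (-1))\<^sup>2"
    proof -
      have c4: "v powr p \<le> 4 powr \<bar>p\<bar> * 1 powr p" if "1 \<le> v" "v \<le> 4" for v p :: real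
        using that by (intro powr_le_powr_of_comparable) auto
      define s where "s = (if t \<ge> 0 then max 0 a else max 0 b)"
      have "(1 - t + 1/lam) powr - a * (1 + t + 1/lam) powr - b \<le> H * lam powr s"
      proof (cases "t \<ge> 0")
        case True
        have "(1 - t + 1/lam) powr - a \<le> 4 powr \<bar>- a\<bar> * lam powr s"
          using rg[OF t] l True by (intro powr_le_of_mem_Icc) (auto simp: s_def)
        moreover have "(1 + t + 1/lam) powr - b \<le> 4 powr \<bar>- b\<bar> * 1 powr - b"
        proof (rule c4)
          show "1 \<le> 1 + t + 1/lam" using True li by linarith
        qed (use rg(2)[OF t] in simp)
        ultimately have "(1 - t + 1/lam) powr - a * (1 + t + 1/lam) powr - b
            \<le> (4 powr \<bar>- a\<bar> * lam powr s) * (4 powr \<bar>- b\<bar> * 1 powr - b)"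
          by (intro mult_mono) auto
        then show ?thesis by (simp add: H_def mult_ac)
      next
        case False
        have "(1 + t + 1/lam) powr - b \<le> 4 powr \<bar>- b\<bar> * lam powr s"
          using rg[OF t] l False by (intro powr_le_of_mem_Icc) (auto simp: s_def)
        moreover have "(1 - t + 1/lam) powr - a \<le> 4 powr \<bar>- a\<bar> * 1 powr - a"
        proof (rule c4)
          show "1 \<le> 1 - t + 1/lam" using False li by linarith
        qed (use rg(1)[OF t] in simp)
        ultimately have "(1 - t + 1/lam) powr - a * (1 + t + 1/lam) powr - b
            \<le> (4 powr \<bar>- a\<bar> * 1 powr - a) * (4 powr \<bar>- b\<bar> * lam powr s)"
          by (intro mult_mono) auto
        then show ?thesis by (simp add: H_def mult_ac)
      qed
      also have "\<dots> \<le> H * lam powr (e + b)"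
      proof -
        \<comment> \<open>For \<open>b \<le> 1\<close> the conditional hypothesis gives
          \<open>0 \<le> e + b\<close> and \<open>a \<le> e + b\<close>; for \<open>b > 1\<close>,
          \<open>a \<le> e + 1\<close> suffices.\<close>
        have "s \<le> e + b" using ab e(1) by (cases "b \<le> 1") (auto simp: s_def)
        then show ?thesis using l by (intro mult_left_mono powr_mono) (auto simp: H_def)
      qed
      finally have "C * S * ((1 - t + 1/lam) powr - a * (1 + t + 1/lam) powr - b) \<le> C * S * (H * lam powr (e + b))"
        using C S by (intro mult_left_mono) auto
      with bd(1)[OF t] have "lam * (poly y t)\<^sup>2 \<le> C * S * (H * lam powr (e + b))" by (rule order_trans)
      also have "\<dots> = C * H * lam powr e * lam * (S * lam powr (b - 1))"
      proof -
        have "lam powr (e + b) = lam powr e * (lam powr (b - 1) * lam)"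
          using l by (simp add: powr_add powr_diff)
        then show ?thesis by simp
      qed
      also have "\<dots> \<le> C * H * lam powr e * lam * (C * (poly y (-1))\<^sup>2)"
        using S C l by (intro mult_left_mono) (auto simp: H_def)
      also have "\<dots> = lam * (C\<^sup>2 * H * lam powr e * (poly y (-1))\<^sup>2)" by (simp add: power2_eq_square)
      finally have "(poly y t)\<^sup>2 \<le> C\<^sup>2 * H * lam powr e * (poly y (-1))\<^sup>2" using l by simp
      also have "\<dots> \<le> K * lam powr e * (poly y (-1))\<^sup>2" using K(2) by (intro mult_right_mono) auto
      finally show ?thesis .
    qed
    show "((1 + t) * poly y t)\<^sup>2 \<le> K * lam powr e * ((1 + x) * poly (pderiv y) x * (t - x))\<^sup>2"
      if x': "x \<in> {-1<..<1}" and root: "poly y x = 0" for x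
    proof -
      have x: "x \<in> {-1..1}" using x' by auto
      define A B A' B' d where "A = 1 - t + 1/lam" and "B = 1 + t + 1/lam"
        and "A' = 1 - x + 1/lam" and "B' = 1 + x + 1/lam" and "d = \<bar>t - x\<bar>"
      have pos: "A > 0" "B > 0" "A' > 0" "B' > 0" using gp[OF t] gp[OF x] by (auto simp: A_def B_def A'_def B'_def)
      define Q where "Q = ((1 + x) * poly (pderiv y) x * (t - x))\<^sup>2"
      have Q: "Q = (1 + x)\<^sup>2 * (poly (pderiv y) x)\<^sup>2 * d\<^sup>2" by (simp add: Q_def d_def power_mult_distrib)
      \<comment> \<open>At a root the shifted distance to -1 is comparable to the true factor 1 + x
        in the denominator.\<close>
      have B': "B'\<^sup>2 \<le> C\<^sup>2 * (1 + x)\<^sup>2"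
        using power_mono[OF bd(4)[OF x root], of 2] pos by (simp add: B'_def power_mult_distrib)
      have r: "S * (A' powr (- a - 1) * B' powr (- b - 1)) \<le> C * (poly (pderiv y) x)\<^sup>2"
        using bd(3)[OF x root] by (simp add: A'_def B'_def)
      have tB: "(1 + t)\<^sup>2 \<le> B\<^sup>2" using t li by (intro power_mono) (auto simp: B_def)
      show ?thesis
      proof (cases "min A' B' \<le> 2 * d")
        case True
        have "A powr - a * B powr (2 - b) * A' powr (a + 1) * B' powr (b - 1) \<le> C0 * lam powr (e + 1) * d\<^sup>2"
        proof (rule ratio[OF l])
          show "A \<in> {1/lam..4}" "B \<in> {1/lam..4}" "A' \<in> {1/lam..4}" "B' \<in> {1/lam..4}"
            unfolding A_def B_def A'_def B'_def by (fact rg[OF t] rg[OF x])+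
          show "A + B \<ge> 2" "A' + B' \<ge> 2" "\<bar>A - A'\<bar> = d" "\<bar>B - B'\<bar> = d"
            using li by (simp_all add: A_def B_def A'_def B'_def d_def abs_minus_commute)
          show "min A' B' \<le> 2 * d" by (fact True)
        qed
        then have rr: "(A powr - a * B powr (2 - b) * A' powr (a + 1) * B' powr (b - 1)) * (A' powr (- a - 1) * B' powr (1 - b))
            \<le> (C0 * lam powr (e + 1) * d\<^sup>2) * (A' powr (- a - 1) * B' powr (1 - b))"
          by (rule mult_right_mono) auto
        \<comment> \<open>Multiplying by the inverse weights of x moves them to the right, where
          \<open>r\<close> and \<open>B'\<close> turn them into y'(x)^2 and (1 + x)^2.\<close>
        have "A' powr (a + 1) * A' powr (- a - 1) = 1" "B' powr (b - 1) * B' powr (1 - b) = 1"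
          using pos by (simp_all add: powr_add[symmetric])
        then have "(A powr - a * B powr (2 - b) * A' powr (a + 1) * B' powr (b - 1)) * (A' powr (- a - 1) * B' powr (1 - b))
            = A powr - a * B powr (2 - b)" by (simp add: mult_ac) algebra
        with rr have rr': "A powr - a * B powr (2 - b) \<le> (C0 * lam powr (e + 1) * d\<^sup>2) * (A' powr (- a - 1) * B' powr (1 - b))"
          by simp
        have "lam * ((1 + t) * poly y t)\<^sup>2 = (1 + t)\<^sup>2 * (lam * (poly y t)\<^sup>2)" by (simp add: power_mult_distrib)
        also have "\<dots> \<le> B\<^sup>2 * (C * S * (A powr - a * B powr - b))"
          using l by (intro mult_mono[OF tB bd(1)[OF t, folded A_def B_def]]) auto
        also have "\<dots> = C * S * (A powr - a * B powr (2 - b))"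
          using pos powr_add[of B 2 "- b"] by simp
        also have "\<dots> \<le> C * S * ((C0 * lam powr (e + 1) * d\<^sup>2) * (A' powr (- a - 1) * B' powr (1 - b)))"
          using rr' C S by (intro mult_left_mono) auto
        also have "\<dots> = C * C0 * lam powr (e + 1) * d\<^sup>2 * (S * (A' powr (- a - 1) * B' powr (- b - 1))) * B'\<^sup>2"
          using pos powr_add[of B' "- b - 1" 2] by simp
        also have "\<dots> \<le> C * C0 * lam powr (e + 1) * d\<^sup>2 * (C * (poly (pderiv y) x)\<^sup>2) * (C\<^sup>2 * (1 + x)\<^sup>2)"
          using C C0 by (intro mult_mono[OF mult_left_mono[OF r] B']) auto
        also have "\<dots> = lam * (C ^ 4 * C0 * lam powr e * Q)"
          using l by (simp add: Q powr_add power2_eq_square power4_eq_xxxx)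
        finally have "((1 + t) * poly y t)\<^sup>2 \<le> C ^ 4 * C0 * lam powr e * Q" using l by simp
        also have "\<dots> \<le> K * lam powr e * Q" using K(3) by (intro mult_right_mono) (auto simp: Q_def)
        finally show ?thesis by (simp add: Q_def)
      next
        case near: False
        \<comment> \<open>Now \<open>d\<close> is below half of both \<open>A'\<close> and
          \<open>B'\<close>, so each point between t and x has shifted distances within a factor 2
          of those of x. The mean value theorem supplies the factor \<open>d\<close> to match t -
          x.\<close>
        obtain \<xi> where xi: "\<xi> \<in> {-1..1}" "\<bar>\<xi> - x\<bar> \<le> d" "(poly y t)\<^sup>2 = d\<^sup>2 * (poly (pderiv y) \<xi>)\<^sup>2"
        proof (cases t x rule: linorder_cases)
          case less
          then obtain \<xi> where "t < \<xi>" "\<xi> < x" "poly y x - poly y t = (x - t) * poly (pderiv y) \<xi>"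
            using poly_MVT by blast
          then have "poly y t = - ((x - t) * poly (pderiv y) \<xi>)" using root by simp
          then have "(poly y t)\<^sup>2 = d\<^sup>2 * (poly (pderiv y) \<xi>)\<^sup>2"
            by (simp add: d_def power_mult_distrib power2_commute)
          then show ?thesis using that[of \<xi>] \<open>t < \<xi>\<close> \<open>\<xi> < x\<close> t x by (auto simp: d_def)
        next
          case equal
          then show ?thesis using that[of x] x root by (simp add: d_def)
        next
          case greater
          then obtain \<xi> where "x < \<xi>" "\<xi> < t" "poly y t - poly y x = (t - x) * poly (pderiv y) \<xi>"
            using poly_MVT by blast
          then have "(poly y t)\<^sup>2 = d\<^sup>2 * (poly (pderiv y) \<xi>)\<^sup>2"
            using root by (simp add: d_def power_mult_distrib)
          then show ?thesis using that[of \<xi>] \<open>x < \<xi>\<close> \<open>\<xi> < t\<close> t x by (auto simp: d_def)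
        qed
        have n: "2 * d < A'" "2 * d < B'" using near by auto
        have bx: "1 - \<xi> + 1/lam = A' + (x - \<xi>)" "1 + \<xi> + 1/lam = B' + (\<xi> - x)" by (simp_all add: A'_def B'_def)
        have pxi: "1 - \<xi> + 1/lam > 0" "1 + \<xi> + 1/lam > 0" using gp[OF xi(1)] by auto
        have "(1 - \<xi> + 1/lam) powr (- a - 1) \<le> 2 powr \<bar>- a - 1\<bar> * A' powr (- a - 1)"
          using pxi pos xi(2) n unfolding bx by (intro powr_le_powr_of_comparable) auto
        moreover have "(1 + \<xi> + 1/lam) powr (- b - 1) \<le> 2 powr \<bar>- b - 1\<bar> * B' powr (- b - 1)"
          using pxi pos xi(2) n unfolding bx by (intro powr_le_powr_of_comparable) auto
        ultimately have "(1 - \<xi> + 1/lam) powr (- a - 1) * (1 + \<xi> + 1/lam) powr (- b - 1)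
            \<le> (2 powr \<bar>- a - 1\<bar> * A' powr (- a - 1)) * (2 powr \<bar>- b - 1\<bar> * B' powr (- b - 1))"
          by (intro mult_mono) auto
        also have "\<dots> = H2 * (A' powr (- a - 1) * B' powr (- b - 1))" by (simp add: H2_def)
        finally have "C * S * ((1 - \<xi> + 1/lam) powr (- a - 1) * (1 + \<xi> + 1/lam) powr (- b - 1))
            \<le> C * S * (H2 * (A' powr (- a - 1) * B' powr (- b - 1)))"
          using C S by (intro mult_left_mono) auto
        with bd(2)[OF xi(1)]
        have "(poly (pderiv y) \<xi>)\<^sup>2 \<le> C * S * (H2 * (A' powr (- a - 1) * B' powr (- b - 1)))" by (rule order_trans)
        also have "\<dots> = C * H2 * (S * (A' powr (- a - 1) * B' powr (- b - 1)))" by simp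
        also have "\<dots> \<le> C * H2 * (C * (poly (pderiv y) x)\<^sup>2)" using r C H2 by (intro mult_left_mono) auto
        finally have dx: "(poly (pderiv y) \<xi>)\<^sup>2 \<le> C * H2 * (C * (poly (pderiv y) x)\<^sup>2)" .
        have "B = B' + (t - x)" "t - x \<le> d" by (simp_all add: B_def B'_def d_def)
        then have "B \<le> 2 * B'" using n pos by linarith
        then have "B\<^sup>2 \<le> (2 * B')\<^sup>2" using pos by (intro power_mono) auto
        then have "(1 + t)\<^sup>2 \<le> 4 * (C\<^sup>2 * (1 + x)\<^sup>2)" using tB B' by (simp add: power_mult_distrib)
        then have "(1 + t)\<^sup>2 * (d\<^sup>2 * (poly (pderiv y) \<xi>)\<^sup>2) \<le> 4 * (C\<^sup>2 * (1 + x)\<^sup>2) * (d\<^sup>2 * (C * H2 * (C * (poly (pderiv y) x)\<^sup>2)))"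
          using dx by (intro mult_mono mult_left_mono) auto
        also have "\<dots> = 4 * C ^ 4 * H2 * Q" unfolding Q by algebra
        finally have "((1 + t) * poly y t)\<^sup>2 \<le> 4 * C ^ 4 * H2 * Q"
          by (simp only: power_mult_distrib xi(3))
        also have "\<dots> \<le> K * Q" using K(4) by (intro mult_right_mono) (auto simp: Q_def)
        also have "\<dots> \<le> K * lam powr e * Q"
          using le1 K(1) mult_left_mono[of 1 "lam powr e" K] by (intro mult_right_mono) (auto simp: Q_def)
        finally show ?thesis by (simp add: Q_def)
      qed
    qed
  qed
  show ?thesis using main K(1) C(2) by blast
qed

section \<open>From squared bounds to the growth of the maximum\<close>

lemma sup_norm_le:
  assumes "\<And>t. t \<in> {-1..1} \<Longrightarrow> \<bar>f t\<bar> \<le> M"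
  shows "0 \<le> sup_norm f" "sup_norm f \<le> M"
proof -
  have "bdd_above ((\<lambda>t. \<bar>f t\<bar>) ` {-1..1})" using assms by (intro bdd_aboveI2) auto
  then have "\<bar>f 0\<bar> \<le> sup_norm f" unfolding sup_norm_def by (intro cSUP_upper) auto
  then show "0 \<le> sup_norm f" by linarith
  show "sup_norm f \<le> M" unfolding sup_norm_def using assms by (intro cSUP_least) auto
qed

theorem mainTheorem9:
  fixes \<alpha> \<beta> :: real
  assumes "\<alpha> > -1" and "\<beta> > -1"
  shows "(\<lambda>n. Max ((\<lambda>j. sup_norm (poly (lagrange_basis n (radau_node \<alpha> \<beta> n) j))) ` {1..n}))
    \<in> O(\<lambda>n. real n powr
        (if \<beta> \<le> 1 / 2
         then - Min {0, \<beta> + 1 / 2, \<beta> - \<alpha>}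
         else - Min {0, 1 / 2 - \<alpha>, 5 / 2 - \<beta>, \<beta> - \<alpha>}))"
proof -
  define e where "e = (if \<beta> \<le> 1 / 2
         then - Min {0, \<beta> + 1 / 2, \<beta> - \<alpha>}
         else - Min {0, 1 / 2 - \<alpha>, 5 / 2 - \<beta>, \<beta> - \<alpha>})"
  have e: "0 \<le> e" "\<beta> - 5/2 \<le> e" "\<alpha> - 1/2 \<le> e" "\<beta> \<le> 1/2 \<Longrightarrow> - \<beta> - 1/2 \<le> e \<and> \<alpha> - \<beta> \<le> e"
    by (auto simp: e_def min_def)
  obtain K lam0 where K: "K \<ge> 1" "lam0 \<ge> 1" and
    bound: "\<And>lam y t. lam \<ge> lam0 \<Longrightarrow> jacobi_ode \<alpha> \<beta> lam y \<Longrightarrow> y \<noteq> 0 \<Longrightarrow> t \<in> {-1..1} \<Longrightarrow>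
       (poly y t)\<^sup>2 \<le> K * lam powr e * (poly y (-1))\<^sup>2 \<and>
       (\<forall>x\<in>{-1<..<1}. poly y x = 0 \<longrightarrow>
          ((1 + t) * poly y t)\<^sup>2 \<le> K * lam powr e * ((1 + x) * poly (pderiv y) x * (t - x))\<^sup>2)"
    using jacobi_ode_radau_bounds[OF assms e] by blast
  define c where "c = 1 + \<bar>\<alpha> + \<beta> + 1\<bar>"
  \<comment> \<open>The square root undoes the squares; \<open>c\<close> is chosen so that
    \<open>lam \<le> c * n^2\<close>.\<close>
  define M where "M = sqrt (K * c powr e)"
  have "norm (Max ((\<lambda>j. sup_norm (poly (lagrange_basis n (radau_node \<alpha> \<beta> n) j))) ` {1..n}))
      \<le> M * norm (real n powr e)" if n: "real n \<ge> lam0 + 2" for n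
  proof -
    have n1: "n \<ge> 1" using n K by linarith
    let ?x = "radau_node \<alpha> \<beta> n"
    define y where "y = jacobi \<alpha> \<beta> (n - 1)"
    define lam where "lam = jacobi_eigenvalue \<alpha> \<beta> (n - 1)"
    have ode: "jacobi_ode \<alpha> \<beta> lam y" unfolding y_def lam_def by (rule jacobi_satisfies_ode[OF assms])
    have "poly y 1 > 0"
      using jacobi_is_family[OF assms] gbinomial_shift_pos[OF assms(1), of "n - 1"]
      by (simp add: is_jacobi_family_def y_def)
    then have y0: "y \<noteq> 0" by auto
    have m: "real (n - 1) = real n - 1" using n1 by (simp add: of_nat_diff)
    have lam_ge: "lam \<ge> lam0"
    proof -
      \<comment> \<open>With degree n - 1 the eigenvalue is (n - 1) (n + \<alpha> + \<beta>), and
        \<alpha> + \<beta> > -2 makes the second factor larger than n - 2.\<close>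
      have "lam0 \<le> 1 * (real n - 1 - 1)" using n by simp
      also have "\<dots> \<le> (real n - 1) * (real n - 1 + \<alpha> + \<beta> + 1)"
        using n K assms by (intro mult_mono) auto
      finally show ?thesis unfolding lam_def jacobi_eigenvalue_def m .
    qed
    have lam_le: "lam \<le> c * (real n)\<^sup>2"
    proof -
      have "real n - 1 + \<alpha> + \<beta> + 1 \<le> c * real n"
      proof -
        define k where "k = \<bar>\<alpha> + \<beta> + 1\<bar>"
        have "k * 1 \<le> k * real n" using n1 by (intro mult_left_mono) (auto simp: k_def)
        moreover have "\<alpha> + \<beta> + 1 \<le> k" by (simp add: k_def)
        ultimately have "real n - 1 + \<alpha> + \<beta> + 1 \<le> real n + k * real n" by linarith
        then show ?thesis by (simp add: c_def k_def distrib_right)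
      qed
      then have "(real n - 1) * (real n - 1 + \<alpha> + \<beta> + 1) \<le> real n * (c * real n)"
        using n1 assms n K by (intro mult_mono) (auto simp: c_def)
      then show ?thesis unfolding lam_def jacobi_eigenvalue_def m by (simp add: power2_eq_square mult_ac)
    qed
    have "K * lam powr e \<le> K * (c * (real n)\<^sup>2) powr e"
      using lam_le lam_ge K e by (intro mult_left_mono powr_mono2) auto
    also have "\<dots> = K * c powr e * (real n powr e)\<^sup>2"
    proof -
      have "((real n)\<^sup>2) powr e = (real n powr e)\<^sup>2"
        by (simp add: power2_eq_square powr_mult)
      then show ?thesis by (simp add: c_def powr_mult)
    qed
    also have "\<dots> = (M * real n powr e)\<^sup>2"
      using K by (simp add: M_def power_mult_distrib c_def)
    finally have KM: "K * lam powr e \<le> (M * real n powr e)\<^sup>2" .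
    have M0: "M * real n powr e \<ge> 0" using K by (simp add: M_def)
    \<comment> \<open>Needed at the node itself, where the Lagrange polynomial equals 1.\<close>
    have "1 \<le> K * lam powr e"
      using K lam_ge e mult_mono[of 1 K 1 "lam powr e"] by (simp add: ge_one_powr_ge_zero)
    then have "1\<^sup>2 \<le> (M * real n powr e)\<^sup>2" using KM by simp
    then have M1: "1 \<le> M * real n powr e" using M0 by (rule power2_le_imp_le)
    note nodes = radau_nodes[OF assms n1, folded y_def]
    obtain s where s: "s \<noteq> 0" "[:1, 1:] * y = smult s (node_poly n ?x)" using nodes(2) by blast
    have f: "poly ([:1, 1:] * y) t = (1 + t) * poly y t" for t by (simp add: algebra_simps)
    have f': "poly (pderiv ([:1, 1:] * y)) t = poly y t + (1 + t) * poly (pderiv y) t" for t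
      unfolding pderiv_mult by (simp add: pderiv_pCons algebra_simps)
    have "\<bar>poly (lagrange_basis n ?x j) t\<bar> \<le> M * real n powr e" if j: "j \<in> {1..n}" and t: "t \<in> {-1..1}" for j t
    proof (cases "t = ?x j")
      case True
      then show ?thesis using lagrange_basis_eval(1)[OF bij_betw_imp_inj_on[OF nodes(1)] j] M1 by simp
    next
      case False
      \<comment> \<open>The first factor is the derivative of (1 + x) y at the node: only y survives
        at -1, only (1 + x) y' at a root of y.\<close>
      define q where "q = (poly y (?x j) + (1 + ?x j) * poly (pderiv y) (?x j)) * (t - ?x j)"
      have ev: "poly (lagrange_basis n ?x j) t = (1 + t) * poly y t / q"
        using lagrange_basis_eval(2)[OF bij_betw_imp_inj_on[OF nodes(1)] j False s(1)]
        unfolding s(2)[symmetric] f f' q_def .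
      have "((1 + t) * poly y t)\<^sup>2 \<le> K * lam powr e * q\<^sup>2"
      proof -
        have "?x j \<in> insert (-1) {x. poly y x = 0}" using bij_betwE[OF nodes(1)] j by blast
        then consider "?x j = -1" | "poly y (?x j) = 0" by blast
        then show ?thesis
        proof cases
          case 1
          have "(1 + t)\<^sup>2 * (poly y t)\<^sup>2 \<le> (1 + t)\<^sup>2 * (K * lam powr e * (poly y (-1))\<^sup>2)"
            using bound[OF lam_ge ode y0 t] by (intro mult_left_mono) auto
          then show ?thesis unfolding q_def 1 by (simp add: power_mult_distrib mult_ac add.commute)
        next
          case 2
          then have "?x j \<in> {-1<..<1}" using jacobi_roots(1)[OF assms, of "n - 1"] by (auto simp: y_def)
          then show ?thesis using bound[OF lam_ge ode y0 t] 2 by (simp add: q_def)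
        qed
      qed
      also have "\<dots> \<le> (M * real n powr e)\<^sup>2 * q\<^sup>2" using KM by (rule mult_right_mono) simp
      finally have "\<bar>(1 + t) * poly y t\<bar>\<^sup>2 \<le> (M * real n powr e * \<bar>q\<bar>)\<^sup>2" by (simp add: power_mult_distrib)
      then have "\<bar>(1 + t) * poly y t\<bar> \<le> M * real n powr e * \<bar>q\<bar>"
        by (rule power2_le_imp_le) (intro mult_nonneg_nonneg[OF M0] abs_ge_zero)
      \<comment> \<open>For \<open>q = 0\<close> the quotient is 0 by convention, and the bound is
        trivial.\<close>
      then show ?thesis unfolding ev using M0
        by (cases "q = 0") (simp_all add: abs_divide divide_le_eq)
    qed
    then have "0 \<le> sup_norm (poly (lagrange_basis n ?x j)) \<and> sup_norm (poly (lagrange_basis n ?x j)) \<le> M * real n powr e"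
      if "j \<in> {1..n}" for j
      using sup_norm_le[of "poly (lagrange_basis n ?x j)" "M * real n powr e"] that by blast
    moreover have "Max ((\<lambda>j. sup_norm (poly (lagrange_basis n ?x j))) ` {1..n}) \<in> (\<lambda>j. sup_norm (poly (lagrange_basis n ?x j))) ` {1..n}"
      using n1 by (intro Max_in) auto
    ultimately show ?thesis by fastforce
  qed
  moreover have "\<forall>\<^sub>F n in sequentially. real n \<ge> lam0 + 2"
    by (rule eventually_at_top_linorderI[of "nat \<lceil>lam0 + 2\<rceil>"]) linarith
  ultimately have "\<forall>\<^sub>F n in sequentially. norm (Max ((\<lambda>j. sup_norm (poly (lagrange_basis n (radau_node \<alpha> \<beta> n) j))) ` {1..n}))
      \<le> M * norm (real n powr e)"
    by (auto elim: eventually_mono)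
  then show ?thesis unfolding e_def[symmetric] by (rule bigoI)
qed

end
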